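(* Let $X$ be a smooth complete vector field on a smooth manifold $M$ and let $X^*$ be its cotangent lift, a vector field on $T^*M$. Then $X^*$ is a Hamiltonian vector field with respect to the canonical symplectic form $\alpha$ on $T^*M$, with Hamiltonian function $$H_X:T^*M\to\mathbb{R},\qquad H_X(p_q)=p(X_q)\quad\text{for } p_q\in T^*_qM,\ q\in M.$$
   Context: For a diffeomorphism $\Phi:M\to M$, its lift to the cotangent bundle is $\Phi_*:T^*M\to T^*M$, which sends $p_q\in T_q^*M$ to the covector $p\circ d(\Phi^{-1})_{\Phi(q)}\in T^*_{\Phi(q)}M$. For a smooth complete vector field $X$ with flow $\{\phi_X^t\}_{t\in\mathbb{R}}$, the lifts $(\phi_X^t)_*$ form a smooth global flow on $T^*M$; the cotangent lift $X^*$ is its infinitesimal generator, $X^*_p=\frac{d}{dt}\big|_{t=0}(\phi_X^t)_*(p)$. With $\pi:T^*M\to M$ the projection, the tautological 1-form is $\theta_p(v)=p(d\pi_p(v))$, $v\in T_pT^*M$, and the canonical symplectic form is $\alpha:=-d\theta$. On a symplectic manifold $(S,\alpha)$, a vector field $Y$ is Hamiltonian with Hamiltonian function $H\in C^\infty(S)$ if $\alpha(Y,\cdot)=dH$. *)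

theory Defs
  imports "HOL-Analysis.Analysis"
begin

text \<open>
  Smoothness on an open set \<open>S\<close> of a finite-dimensional space, by iterated directional derivatives:
  the last derivatives are required to be continuous, so \<open>Ck_on k S f\<close> is the usual \<open>C\<close>-\<open>k\<close> condition.
\<close>

primrec Ck_on :: "nat \<Rightarrow> 'e::real_normed_vector set \<Rightarrow> ('e \<Rightarrow> 'f::real_normed_vector) \<Rightarrow> bool" where
  "Ck_on 0 S f \<longleftrightarrow> continuous_on S f"
| "Ck_on (Suc k) S f \<longleftrightarrow>
     (\<forall>x\<in>S. f differentiable (at x)) \<and> (\<forall>v. Ck_on k S (\<lambda>x. frechet_derivative f (at x) v))"

definition smooth_on :: "'e::real_normed_vector set \<Rightarrow> ('e \<Rightarrow> 'f::real_normed_vector) \<Rightarrow> bool" where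
  "smooth_on S f \<longleftrightarrow> (\<forall>k. Ck_on k S f)"


section \<open>Smooth manifolds\<close>

text \<open>
  A chart is a pair of a domain and a coordinate map; the values of the map off the domain are junk
  and are never used. The model space \<open>'e\<close> is required to be of finite dimension explicitly, and not
  by the class \<open>euclidean_space\<close>, because that class excludes dimension 0. (Such a space is
  automatically complete, so the sort \<open>banach\<close> adds nothing to \<open>real_inner\<close>.)
  The atlas need not be maximal.
\<close>

type_synonym ('a, 'e) chart = "'a set \<times> ('a \<Rightarrow> 'e)"

definition chart_inv :: "('a, 'e) chart \<Rightarrow> 'e \<Rightarrow> 'a" where
  "chart_inv c = inv_into (fst c) (snd c)"

definition smooth_manifold :: "'a topology \<Rightarrow> ('a, 'e::real_normed_vector) chart set \<Rightarrow> bool" where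
  "smooth_manifold M A \<longleftrightarrow>
     (\<exists>B::'e set. finite B \<and> span B = UNIV) \<and>
     Hausdorff_space M \<and> second_countable M \<and>
     (\<Union>c\<in>A. fst c) = topspace M \<and>
     (\<forall>c\<in>A. openin M (fst c) \<and> open (snd c ` fst c) \<and>
        homeomorphic_map (subtopology M (fst c)) (top_of_set (snd c ` fst c)) (snd c)) \<and>
     (\<forall>c\<in>A. \<forall>d\<in>A. smooth_on (snd c ` (fst c \<inter> fst d)) (snd d \<circ> chart_inv c))"

definition carrier_of :: "('a, 'e) chart set \<Rightarrow> 'a set" where
  "carrier_of A = (\<Union>c\<in>A. fst c)"

text \<open>
  A chart around a point, for definitions in local coordinates that do not depend on the chart.
\<close>

definition chart_at :: "('a, 'e) chart set \<Rightarrow> 'a \<Rightarrow> ('a, 'e) chart" where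
  "chart_at A q = (SOME c. c \<in> A \<and> q \<in> fst c)"

text \<open>
  A tangent vector at \<open>q\<close> is the family of its coordinate vectors \<open>v c\<close> in all charts \<open>c\<close> around \<open>q\<close>,
  related by the differentials of the coordinate changes, and 0 at all other arguments. The vector
  space structure is pointwise.
\<close>

definition tangent_space ::
  "('a, 'e::real_normed_vector) chart set \<Rightarrow> 'a \<Rightarrow> (('a, 'e) chart \<Rightarrow> 'e) set" where
  "tangent_space A q = {v.
     (\<forall>c. \<not> (c \<in> A \<and> q \<in> fst c) \<longrightarrow> v c = 0) \<and>
     (\<forall>c\<in>A. \<forall>d\<in>A. q \<in> fst c \<inter> fst d \<longrightarrow>
        v d = frechet_derivative (snd d \<circ> chart_inv c) (at (snd c q)) (v c))}"

text \<open>The tangent vector at \<open>q\<close> that has coordinates \<open>u\<close> in the chart \<open>c\<close>.\<close>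

definition coord_vector ::
  "('a, 'e::real_normed_vector) chart set \<Rightarrow> ('a, 'e) chart \<Rightarrow> 'a \<Rightarrow> 'e \<Rightarrow> (('a, 'e) chart \<Rightarrow> 'e)" where
  "coord_vector A c q u = (\<lambda>d. if d \<in> A \<and> q \<in> fst d
     then frechet_derivative (snd d \<circ> chart_inv c) (at (snd c q)) u else 0)"

text \<open>The differential at \<open>q\<close> of a map \<open>F\<close> between the manifolds with atlases \<open>A\<close> and \<open>B\<close>.\<close>

definition differential ::
  "('a, 'e::real_normed_vector) chart set \<Rightarrow> ('b, 'f::real_normed_vector) chart set \<Rightarrow> ('a \<Rightarrow> 'b) \<Rightarrow> 'a
    \<Rightarrow> (('a, 'e) chart \<Rightarrow> 'e) \<Rightarrow> (('b, 'f) chart \<Rightarrow> 'f)" where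
  "differential A B F q v = (\<lambda>d. if d \<in> B \<and> F q \<in> fst d
     then let c = chart_at A q in
       frechet_derivative (snd d \<circ> F \<circ> chart_inv c) (at (snd c q)) (v c)
     else 0)"


section \<open>Functions, vector fields and 1-forms\<close>

definition smooth_function :: "('a, 'e::real_normed_vector) chart set \<Rightarrow> ('a \<Rightarrow> real) \<Rightarrow> bool" where
  "smooth_function A H \<longleftrightarrow> (\<forall>c\<in>A. smooth_on (snd c ` fst c) (H \<circ> chart_inv c))"

definition function_differential ::
  "('a, 'e::real_normed_vector) chart set \<Rightarrow> ('a \<Rightarrow> real) \<Rightarrow> 'a \<Rightarrow> (('a, 'e) chart \<Rightarrow> 'e) \<Rightarrow> real" where
  "function_differential A H q v =
     (let c = chart_at A q in frechet_derivative (H \<circ> chart_inv c) (at (snd c q)) (v c))"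

definition smooth_vector_field ::
  "('a, 'e::real_normed_vector) chart set \<Rightarrow> ('a \<Rightarrow> (('a, 'e) chart \<Rightarrow> 'e)) \<Rightarrow> bool" where
  "smooth_vector_field A X \<longleftrightarrow>
     (\<forall>q\<in>carrier_of A. X q \<in> tangent_space A q) \<and>
     (\<forall>c\<in>A. smooth_on (snd c ` fst c) (\<lambda>x. X (chart_inv c x) c))"

text \<open>
  In local coordinates, \<open>d\<omega>(v,w) = D(\<omega>(w))v - D(\<omega>(v))w\<close> with \<open>v\<close> and \<open>w\<close> extended by constant
  coordinates; that is, \<open>d(f dg) = df \<and> dg\<close> with \<open>(\<beta> \<and> \<gamma>)(v,w) = \<beta>(v)\<gamma>(w) - \<beta>(w)\<gamma>(v)\<close>.
\<close>

definition exterior_derivative ::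
  "('a, 'e::real_normed_vector) chart set \<Rightarrow> ('a \<Rightarrow> (('a, 'e) chart \<Rightarrow> 'e) \<Rightarrow> real)
    \<Rightarrow> 'a \<Rightarrow> (('a, 'e) chart \<Rightarrow> 'e) \<Rightarrow> (('a, 'e) chart \<Rightarrow> 'e) \<Rightarrow> real" where
  "exterior_derivative A \<omega> q v w =
     (let c = chart_at A q;
          \<omega>c = (\<lambda>u x. \<omega> (chart_inv c x) (coord_vector A c (chart_inv c x) u))
      in frechet_derivative (\<omega>c (w c)) (at (snd c q)) (v c)
         - frechet_derivative (\<omega>c (v c)) (at (snd c q)) (w c))"

definition hamiltonian_vector_field ::
  "('a, 'e::real_normed_vector) chart set
    \<Rightarrow> ('a \<Rightarrow> (('a, 'e) chart \<Rightarrow> 'e) \<Rightarrow> (('a, 'e) chart \<Rightarrow> 'e) \<Rightarrow> real)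
    \<Rightarrow> ('a \<Rightarrow> (('a, 'e) chart \<Rightarrow> 'e)) \<Rightarrow> ('a \<Rightarrow> real) \<Rightarrow> bool" where
  "hamiltonian_vector_field A \<alpha> Y H \<longleftrightarrow>
     smooth_vector_field A Y \<and> smooth_function A H \<and>
     (\<forall>z\<in>carrier_of A. \<forall>w\<in>tangent_space A z. \<alpha> z (Y z) w = function_differential A H z w)"


section \<open>Curves and flows\<close>

text \<open>
  The first condition on the charts says that the curve is continuous at \<open>t\<close>; without it, junk values
  of the coordinate map off its domain would enter.
\<close>

definition has_velocity ::
  "('a, 'e::real_normed_vector) chart set \<Rightarrow> (real \<Rightarrow> 'a) \<Rightarrow> real \<Rightarrow> (('a, 'e) chart \<Rightarrow> 'e) \<Rightarrow> bool" where
  "has_velocity A \<gamma> t v \<longleftrightarrow>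
     \<gamma> t \<in> carrier_of A \<and> v \<in> tangent_space A (\<gamma> t) \<and>
     (\<forall>c\<in>A. \<gamma> t \<in> fst c \<longrightarrow>
        (\<forall>\<^sub>F s in nhds t. \<gamma> s \<in> fst c) \<and> ((snd c \<circ> \<gamma>) has_vector_derivative v c) (at t))"

definition velocity ::
  "('a, 'e::real_normed_vector) chart set \<Rightarrow> (real \<Rightarrow> 'a) \<Rightarrow> real \<Rightarrow> (('a, 'e) chart \<Rightarrow> 'e)" where
  "velocity A \<gamma> t = (THE v. has_velocity A \<gamma> t v)"

definition global_integral_curve ::
  "('a, 'e::real_normed_vector) chart set \<Rightarrow> ('a \<Rightarrow> (('a, 'e) chart \<Rightarrow> 'e)) \<Rightarrow> (real \<Rightarrow> 'a) \<Rightarrow> bool" where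
  "global_integral_curve A X \<gamma> \<longleftrightarrow> (\<forall>t. has_velocity A \<gamma> t (X (\<gamma> t)))"

definition complete_vector_field ::
  "('a, 'e::real_normed_vector) chart set \<Rightarrow> ('a \<Rightarrow> (('a, 'e) chart \<Rightarrow> 'e)) \<Rightarrow> bool" where
  "complete_vector_field A X \<longleftrightarrow>
     (\<forall>q\<in>carrier_of A. \<exists>\<gamma>. global_integral_curve A X \<gamma> \<and> \<gamma> 0 = q)"

text \<open>On a Hausdorff manifold, integral curves of a smooth vector field are unique.\<close>

definition flow_of ::
  "('a, 'e::real_normed_vector) chart set \<Rightarrow> ('a \<Rightarrow> (('a, 'e) chart \<Rightarrow> 'e)) \<Rightarrow> real \<Rightarrow> 'a \<Rightarrow> 'a" where
  "flow_of A X t q = (THE \<gamma>. global_integral_curve A X \<gamma> \<and> \<gamma> 0 = q) t"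


section \<open>The cotangent bundle\<close>

text \<open>Covectors are linear on the tangent space and, to be determined by their values there, 0 off it.\<close>

definition cotangent_space ::
  "('a, 'e::real_normed_vector) chart set \<Rightarrow> 'a \<Rightarrow> ((('a, 'e) chart \<Rightarrow> 'e) \<Rightarrow> real) set" where
  "cotangent_space A q = {p.
     (\<forall>v\<in>tangent_space A q. \<forall>w\<in>tangent_space A q. p (\<lambda>c. v c + w c) = p v + p w) \<and>
     (\<forall>r. \<forall>v\<in>tangent_space A q. p (\<lambda>c. r *\<^sub>R v c) = r * p v) \<and>
     (\<forall>v. v \<notin> tangent_space A q \<longrightarrow> p v = 0)}"

type_synonym ('a, 'e) covector = "'a \<times> ((('a, 'e) chart \<Rightarrow> 'e) \<Rightarrow> real)"

text \<open>
  The chart \<open>(q, p) \<mapsto> (x, \<xi>)\<close> of the cotangent bundle induced by a chart \<open>c\<close> of the base: \<open>x\<close> is the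
  coordinate of \<open>q\<close>, and \<open>p\<close> is \<open>\<xi> dx\<close>, with the dual of the model space identified with the model
  space by its inner product.
\<close>

definition cotangent_chart ::
  "('a, 'e::real_inner) chart set \<Rightarrow> ('a, 'e) chart \<Rightarrow> (('a, 'e) covector, 'e \<times> 'e) chart" where
  "cotangent_chart A c =
     ((SIGMA q:fst c. cotangent_space A q),
      (\<lambda>(q, p). (snd c q, THE \<xi>. \<forall>v\<in>tangent_space A q. p v = \<xi> \<bullet> v c)))"

text \<open>
  The carrier of this atlas is the set of all pairs \<open>(q, p)\<close> with \<open>p\<close> in the cotangent space at \<open>q\<close>.
\<close>

definition cotangent_atlas ::
  "('a, 'e::real_inner) chart set \<Rightarrow> (('a, 'e) covector, 'e \<times> 'e) chart set" where
  "cotangent_atlas A = cotangent_chart A ` A"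

definition tautological_form ::
  "('a, 'e::real_inner) chart set
    \<Rightarrow> ('a, 'e) covector \<Rightarrow> ((('a, 'e) covector, 'e \<times> 'e) chart \<Rightarrow> 'e \<times> 'e) \<Rightarrow> real" where
  "tautological_form A z v = snd z (differential (cotangent_atlas A) A fst z v)"

definition canonical_symplectic_form ::
  "('a, 'e::real_inner) chart set \<Rightarrow> ('a, 'e) covector
    \<Rightarrow> ((('a, 'e) covector, 'e \<times> 'e) chart \<Rightarrow> 'e \<times> 'e)
    \<Rightarrow> ((('a, 'e) covector, 'e \<times> 'e) chart \<Rightarrow> 'e \<times> 'e) \<Rightarrow> real" where
  "canonical_symplectic_form A z v w =
     - exterior_derivative (cotangent_atlas A) (tautological_form A) z v w"

text \<open>The lift of a diffeomorphism.\<close>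

definition cotangent_lift ::
  "('a, 'e::real_normed_vector) chart set \<Rightarrow> ('a \<Rightarrow> 'a) \<Rightarrow> ('a, 'e) covector \<Rightarrow> ('a, 'e) covector" where
  "cotangent_lift A \<Phi> = (\<lambda>(q, p).
     (\<Phi> q, \<lambda>v. if v \<in> tangent_space A (\<Phi> q)
               then p (differential A A (inv_into (carrier_of A) \<Phi>) (\<Phi> q) v) else 0))"

definition cotangent_lift_vector_field ::
  "('a, 'e::real_inner) chart set \<Rightarrow> ('a \<Rightarrow> (('a, 'e) chart \<Rightarrow> 'e))
    \<Rightarrow> ('a, 'e) covector \<Rightarrow> ((('a, 'e) covector, 'e \<times> 'e) chart \<Rightarrow> 'e \<times> 'e)" where
  "cotangent_lift_vector_field A X z =
     velocity (cotangent_atlas A) (\<lambda>t. cotangent_lift A (flow_of A X t) z) 0"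

end

theory Submission
  imports Defs
begin

text \<open>
  In the coordinates \<open>(x, \<xi>)\<close> of the cotangent bundle the tautological form is \<open>\<xi> dx\<close>, hence
  \<open>\<alpha>((a, \<beta>), (a', \<beta>')) = \<beta>' \<bullet> a - \<beta> \<bullet> a'\<close>. The lifted flow moves \<open>(x, \<xi>)\<close> to the point \<open>\<phi>\<^sup>t x\<close> with the covector
  \<open>\<xi>\<close> composed with the derivative of \<open>\<phi>\<close> at time \<open>-t\<close>. That derivative is \<open>1 - t Df(x) + O(t^2)\<close>, where \<open>f\<close> represents
  \<open>X\<close>, so the lifted field is represented by \<open>(f(x), -Df(x)\<^sup>T \<xi>)\<close>, and pairing it with \<open>\<alpha>\<close> gives the
  differential of \<open>\<xi> \<bullet> f(x)\<close>.
\<close>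

subsection \<open>Functions with continuous iterated derivatives\<close>

text \<open>The velocity of the lifted flow is a mixed derivative, in space and in time. The
  hypotheses give one curve through each point and say nothing about how it depends on that point,
  so both the existence of the spatial derivative and its expansion in t have to be extracted from
  the differential equation. This is done by estimates for small times in a single coordinate ball,
  which is enough because \<open>cotangent_lift_vector_field\<close> is a velocity at time 0. Such
  estimates presuppose that all curves starting near x stay in one chart for a common time; this
  confinement uses completeness of the model space and the Hausdorff property. A further difficulty
  is that the backward flow is differentiated at the moving point \<open>\<phi>\<^sup>t x\<close>,
  whereas the expansion refers to \<open>Df\<close> at x. That point has moved only by O(t), so the
  change of base point costs O(t^2). Smoothness of the lifted field is then read off its coordinate
  expression.\<close>

lemma frechet_derivative_eqI:
  "(f has_derivative D) (at x) \<Longrightarrow> frechet_derivative f (at x) = D"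
  by (metis frechet_derivative_at)

text \<open>A derivative at a point depends on the values in a neighbourhood; as \<open>S\<close> is
  open, agreement on \<open>S\<close> passes to the derivatives and the induction can
  proceed.\<close>

lemma Ck_on_cong:
  assumes "open S" "\<And>x. x \<in> S \<Longrightarrow> f x = g x"
  shows "Ck_on k S f \<longleftrightarrow> Ck_on k S g"
proof -
  have "Ck_on k S g" if "\<And>x. x \<in> S \<Longrightarrow> f x = g x" "Ck_on k S f" for f g
    using that
  proof (induction k arbitrary: f g)
    case 0
    then show ?case by (simp add: continuous_on_eq)
  next
    case (Suc k)
    have D: "(g has_derivative frechet_derivative f (at x)) (at x)" if "x \<in> S" for x
    proof (rule has_derivative_transform_within_open[OF _ \<open>open S\<close> that])
      show "(f has_derivative frechet_derivative f (at x)) (at x)"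
        using Suc.prems(2) that frechet_derivative_works by auto
    qed (use Suc.prems in auto)
    have "Ck_on k S (\<lambda>x. frechet_derivative g (at x) v)" for v
    proof (rule Suc.IH)
      show "Ck_on k S (\<lambda>x. frechet_derivative f (at x) v)"
        using Suc.prems(2) by simp
    qed (simp add: frechet_derivative_eqI[OF D])
    moreover have "g differentiable (at x)" if "x \<in> S" for x
      using D[OF that] by (auto simp: differentiable_def)
    ultimately show ?case
      by simp
  qed
  from this[of f g] this[of g f] assms(2) show ?thesis
    by auto
qed

text \<open>Allows an explicitly known derivative in place of \<open>frechet_derivative\<close>, so
  that regularity of sums, products and compositions is proved by induction over the derivative
  formulas.\<close>

lemma Ck_on_SucI:
  assumes "open S" "\<And>x. x \<in> S \<Longrightarrow> (f has_derivative D x) (at x)"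
    "\<And>v. Ck_on k S (\<lambda>x. D x v)"
  shows "Ck_on (Suc k) S f"
proof -
  have "Ck_on k S (\<lambda>x. frechet_derivative f (at x) v)" for v
    using Ck_on_cong[OF assms(1), of "\<lambda>x. frechet_derivative f (at x) v" "\<lambda>x. D x v"] assms(3)
    by (simp add: frechet_derivative_eqI[OF assms(2)])
  moreover have "f differentiable (at x)" if "x \<in> S" for x
    using assms(2)[OF that] by (auto simp: differentiable_def)
  ultimately show ?thesis
    by simp
qed

lemma Ck_on_SucD:
  assumes "Ck_on (Suc k) S f" "x \<in> S"
  shows "(f has_derivative frechet_derivative f (at x)) (at x)"
  using assms frechet_derivative_works by auto

lemma Ck_on_SucD':
  "Ck_on (Suc k) S f \<Longrightarrow> Ck_on k S (\<lambda>x. frechet_derivative f (at x) v)"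
  by simp

lemma Ck_on_Suc_imp_Ck_on: "Ck_on (Suc k) S f \<Longrightarrow> Ck_on k S f"
proof (induction k arbitrary: f)
  case 0
  then show ?case
    by (auto simp: continuous_on_eq_continuous_at differentiable_imp_continuous_within
        intro!: continuous_at_imp_continuous_on)
next
  case (Suc k)
  then show ?case by (auto simp del: Ck_on.simps(1))
qed

lemma Ck_on_const: "Ck_on k S (\<lambda>x. c)"
  by (induction k arbitrary: c) (auto simp: frechet_derivative_const)

lemma Ck_on_bounded_linear:
  assumes "bounded_linear g" "open S"
  shows "Ck_on k S g"
proof (cases k)
  case 0
  then show ?thesis
    using assms by (simp add: linear_continuous_on)
next
  case (Suc k')
  show ?thesis
    unfolding Suc
    by (rule Ck_on_SucI[where D = "\<lambda>x. g"])
      (use assms in \<open>auto simp: Ck_on_const intro: bounded_linear_imp_has_derivative\<close>)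
qed

lemma Ck_on_compose_bounded_linear:
  assumes "bounded_linear g" "open S" "Ck_on k S f"
  shows "Ck_on k S (\<lambda>x. g (f x))"
  using assms(3)
proof (induction k arbitrary: f)
  case 0
  then show ?case
    using assms(1) by (simp add: bounded_linear.continuous_on)
next
  case (Suc k)
  show ?case
  proof (rule Ck_on_SucI[OF assms(2)])
    show "((\<lambda>x. g (f x)) has_derivative (\<lambda>v. g (frechet_derivative f (at x) v))) (at x)"
      if "x \<in> S" for x
      using Ck_on_SucD[OF Suc.prems that] assms(1) by (rule bounded_linear.has_derivative[rotated])
    show "Ck_on k S (\<lambda>x. g (frechet_derivative f (at x) v))" for v
      using Suc.IH Suc.prems by simp
  qed
qed

lemma Ck_on_add:
  assumes "open S" "Ck_on k S f" "Ck_on k S g"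
  shows "Ck_on k S (\<lambda>x. f x + g x)"
  using assms(2,3)
proof (induction k arbitrary: f g)
  case 0
  then show ?case
    by (simp add: continuous_on_add)
next
  case (Suc k)
  show ?case
  proof (rule Ck_on_SucI[OF assms(1)])
    show "((\<lambda>x. f x + g x) has_derivative
        (\<lambda>v. frechet_derivative f (at x) v + frechet_derivative g (at x) v)) (at x)"
      if "x \<in> S" for x
      using Ck_on_SucD[OF Suc.prems(1) that] Ck_on_SucD[OF Suc.prems(2) that]
      by (rule has_derivative_add)
    show "Ck_on k S (\<lambda>x. frechet_derivative f (at x) v + frechet_derivative g (at x) v)" for v
      using Suc.IH Suc.prems by simp
  qed
qed

lemma Ck_on_sum:
  assumes "open S" "\<And>i. i \<in> I \<Longrightarrow> Ck_on k S (f i)"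
  shows "Ck_on k S (\<lambda>x. \<Sum>i\<in>I. f i x)"
  using assms(2)
  by (induction I rule: infinite_finite_induct) (auto simp: Ck_on_const intro!: Ck_on_add assms(1))

lemma (in bounded_bilinear) Ck_on_prod:
  assumes "open S" "Ck_on k S f" "Ck_on k S g"
  shows "Ck_on k S (\<lambda>x. prod (f x) (g x))"
  using assms(2,3)
proof (induction k arbitrary: f g)
  case 0
  then show ?case
    by (simp add: continuous_on)
next
  case (Suc k)
  show ?case
  proof (rule Ck_on_SucI[OF assms(1)])
    show "((\<lambda>x. prod (f x) (g x)) has_derivative
        (\<lambda>v. prod (f x) (frechet_derivative g (at x) v) + prod (frechet_derivative f (at x) v) (g x))) (at x)"
      if "x \<in> S" for x
      using Ck_on_SucD[OF Suc.prems(1) that] Ck_on_SucD[OF Suc.prems(2) that]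
      by (rule FDERIV)
    \<comment> \<open>The product rule brings back the undifferentiated factors; for these, order
      \<open>Suc k\<close> is lowered to order \<open>k\<close>.\<close>
    show "Ck_on k S (\<lambda>x. prod (f x) (frechet_derivative g (at x) v)
        + prod (frechet_derivative f (at x) v) (g x))" for v
      using Suc.prems
      by (intro Ck_on_add[OF assms(1)] Suc.IH Ck_on_SucD')
        (simp_all only: Ck_on_Suc_imp_Ck_on)
  qed
qed

text \<open>The coordinate expressions on the bundle are constant or linear in the fibre coordinate,
  with coefficients pulled back from the base along the projection.\<close>

lemma Ck_on_fst:
  assumes "open S" "Ck_on k S f"
  shows "Ck_on k (S \<times> (UNIV :: 'd::real_normed_vector set)) (\<lambda>z. f (fst z))"
  using assms(2)
proof (induction k arbitrary: f)
  case 0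
  then show ?case
    by (auto intro!: continuous_intros continuous_on_compose2[of S f])
next
  case (Suc k)
  show ?case
  proof (rule Ck_on_SucI)
    show "((\<lambda>z. f (fst z)) has_derivative (\<lambda>v. frechet_derivative f (at (fst z)) (fst v))) (at z)"
      if "z \<in> S \<times> UNIV" for z
    proof (rule has_derivative_compose[OF has_derivative_fst[OF has_derivative_ident]])
      show "(f has_derivative frechet_derivative f (at (fst z))) (at (fst z))"
        using Ck_on_SucD[OF Suc.prems] that by auto
    qed
    show "Ck_on k (S \<times> (UNIV :: 'd set)) (\<lambda>z. frechet_derivative f (at (fst z)) (fst v))"
      for v :: "'a \<times> 'd"
      using Suc.prems by (intro Suc.IH) simp
  qed (use assms in \<open>auto intro: open_Times\<close>)
qed

lemma Ck_on_Pair: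
  assumes "open S" "Ck_on k S f" "Ck_on k S g"
  shows "Ck_on k S (\<lambda>x. (f x, g x))"
proof -
  have "Ck_on k S (\<lambda>x. (f x, 0) + (0, g x))"
    using assms
    by (intro Ck_on_add Ck_on_compose_bounded_linear[of "\<lambda>y. (y, 0)"]
        Ck_on_compose_bounded_linear[of "\<lambda>y. (0, y)"])
      (auto intro!: bounded_linear_intros bounded_linear_Pair)
  then show ?thesis
    by simp
qed


subsection \<open>Parseval frames\<close>

text \<open>
  Sort \<open>euclidean_space\<close> is not available, as it excludes dimension 0; the identity below is all that
  is used of an orthonormal basis.
\<close>

definition parseval :: "'e::real_inner set \<Rightarrow> bool" where
  "parseval B \<longleftrightarrow> finite B \<and> (\<forall>x. (\<Sum>b\<in>B. (x \<bullet> b) *\<^sub>R b) = x)"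

text \<open>An orthogonal spanning set is freed of 0 and normalised. The expansion is linear in
  \<open>x\<close>, so it is checked on the spanning set only, where orthogonality leaves a single
  term.\<close>

lemma parseval_exists:
  assumes "finite B" "span B = (UNIV :: 'e::real_inner set)"
  shows "\<exists>C::'e set. parseval C"
proof -
  obtain C0 :: "'e set" where C0: "finite C0" "span C0 = UNIV" "pairwise orthogonal C0"
    using basis_orthogonal[OF assms(1)] assms(2) by auto
  define C where "C = C0 - {0}"
  have C: "finite C" "span C = UNIV" "0 \<notin> C"
    using C0 by (auto simp: C_def span_delete_0)
  have orth: "b \<bullet> c = 0" if "b \<in> C" "c \<in> C" "b \<noteq> c" for b c
    using C0(3) that by (auto simp: C_def pairwise_def orthogonal_def)
  \<comment> \<open>The sum over the normalised set is to be rewritten as a sum over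
    \<open>C\<close>. Two orthogonal nonzero vectors with equal normalisations would yield a unit
    vector orthogonal to itself.\<close>
  have inj: "inj_on sgn C"
  proof (rule inj_onI, rule ccontr)
    fix b c assume bc: "b \<in> C" "c \<in> C" "sgn b = sgn c" "b \<noteq> c"
    have "sgn b \<bullet> sgn c = 0"
      using orth[OF bc(1,2,4)] by (simp add: sgn_div_norm)
    then show False
      using bc C(3) by (auto simp: sgn_zero_iff)
  qed
  have "(\<Sum>b\<in>C. (x \<bullet> sgn b) *\<^sub>R sgn b) = x" for x
  proof (rule linear_eq_on_span[of "\<lambda>x. \<Sum>b\<in>C. (x \<bullet> sgn b) *\<^sub>R sgn b" "\<lambda>x. x" C])
    show "linear (\<lambda>x. \<Sum>b\<in>C. (x \<bullet> sgn b) *\<^sub>R sgn b)"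
      by (rule linearI)
        (simp_all add: inner_add_left scaleR_add_left sum.distrib scaleR_sum_right)
    show "linear (\<lambda>x::'e. x)"
      by (rule linear_ident)
    fix x assume x: "x \<in> C"
    have "(\<Sum>b\<in>C. (x \<bullet> sgn b) *\<^sub>R sgn b) = (\<Sum>b\<in>{x}. (x \<bullet> sgn b) *\<^sub>R sgn b)"
      by (rule sum.mono_neutral_right) (use C x orth in \<open>auto simp: sgn_div_norm\<close>)
    also have "\<dots> = x"
    proof -
      have "norm x \<noteq> 0"
        using x C(3) by auto
      then show ?thesis
        by (simp add: sgn_div_norm dot_square_norm power2_eq_square field_simps)
    qed
    finally show "(\<Sum>b\<in>C. (x \<bullet> sgn b) *\<^sub>R sgn b) = x" .
  qed (use C in auto)
  then have "parseval (sgn ` C)"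
    unfolding parseval_def using C(1) inj by (simp add: sum.reindex)
  then show ?thesis ..
qed

lemma parseval_linear:
  assumes "parseval B" "linear g"
  shows "g v = (\<Sum>b\<in>B. (v \<bullet> b) *\<^sub>R g b)"
proof -
  have "g (\<Sum>b\<in>B. (v \<bullet> b) *\<^sub>R b) = (\<Sum>b\<in>B. (v \<bullet> b) *\<^sub>R g b)"
    by (simp add: linear_sum[OF assms(2)] linear_cmul[OF assms(2)])
  then show ?thesis
    using assms(1) by (simp add: parseval_def)
qed

lemma parseval_riesz:
  assumes "parseval B" "linear g"
  shows "(\<Sum>b\<in>B. (g b :: real) *\<^sub>R b) \<bullet> v = g v"
proof -
  have "(\<Sum>b\<in>B. g b *\<^sub>R b) \<bullet> v = (\<Sum>b\<in>B. (v \<bullet> b) *\<^sub>R g b)"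
    by (simp add: inner_sum_left inner_commute[of v] mult.commute)
  then show ?thesis
    by (simp only: parseval_linear[OF assms, of v])
qed

text \<open>\<open>Ck_on\<close> controls derivatives one direction at a time; the finitely many
  directions of a frame suffice for a bound that is uniform in the direction.\<close>

lemma parseval_bound:
  assumes "parseval B" "linear g" "\<And>b. b \<in> B \<Longrightarrow> norm (g b) \<le> m"
  shows "norm (g v) \<le> m * (\<Sum>b\<in>B. norm b) * norm v"
proof -
  have "norm (g v) \<le> (\<Sum>b\<in>B. norm ((v \<bullet> b) *\<^sub>R g b))"
    by (subst parseval_linear[OF assms(1,2)]) (rule norm_sum)
  also have "\<dots> \<le> (\<Sum>b\<in>B. (norm v * norm b) * m)"
  proof (rule sum_mono)
    fix b assume "b \<in> B"
    then show "norm ((v \<bullet> b) *\<^sub>R g b) \<le> (norm v * norm b) * m"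
      unfolding norm_scaleR by (intro mult_mono assms(3) Cauchy_Schwarz_ineq2) auto
  qed
  also have "\<dots> = m * (\<Sum>b\<in>B. norm b) * norm v"
    by (simp add: sum_distrib_left sum_distrib_right mult_ac)
  finally show ?thesis .
qed


subsection \<open>Differential inequalities and differentiability\<close>

lemma vector_derivative_bound:
  fixes z :: "real \<Rightarrow> 'e::real_normed_vector"
  assumes "convex S" "\<And>s. s \<in> S \<Longrightarrow> (z has_vector_derivative z' s) (at s)"
    "\<And>s. s \<in> S \<Longrightarrow> norm (z' s) \<le> B" "a \<in> S" "b \<in> S"
  shows "norm (z a - z b) \<le> B * \<bar>a - b\<bar>"
proof -
  have "norm (z a - z b) \<le> B * norm (a - b)"
  proof (rule differentiable_bound[OF assms(1) _ _ assms(4,5)])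
    fix s assume s: "s \<in> S"
    show "(z has_derivative (\<lambda>h. h *\<^sub>R z' s)) (at s within S)"
      using assms(2)[OF s] has_derivative_at_withinI unfolding has_vector_derivative_def by blast
    show "onorm (\<lambda>h. h *\<^sub>R z' s) \<le> B"
    proof (rule onorm_le)
      show "norm (h *\<^sub>R z' s) \<le> B * norm h" for h :: real
        using mult_right_mono[OF assms(3)[OF s] abs_ge_zero[of h]] by (simp add: mult.commute)
    qed
  qed
  then show ?thesis
    by simp
qed

text \<open>At a time \<open>s0\<close> where the norm is maximal,
  \<open>norm (z s0) \<le> norm (z 0) + (L * norm (z s0) + m) * T\<close>. As
  \<open>L * T \<le> 1/2\<close>, the term with \<open>L\<close> is absorbed by half of the left
  side; this replaces the exponential and produces the factor 2.\<close>

lemma small_time_gronwall: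
  fixes z :: "real \<Rightarrow> 'e::real_normed_vector"
  assumes T: "0 \<le> T" "L * T \<le> 1/2" "0 \<le> L"
    and D: "\<And>s. \<bar>s\<bar> \<le> T \<Longrightarrow> (z has_vector_derivative z' s) (at s)"
    and B: "\<And>s. \<bar>s\<bar> \<le> T \<Longrightarrow> norm (z' s) \<le> L * norm (z s) + m"
    and s: "\<bar>s\<bar> \<le> T"
  shows "norm (z s) \<le> 2 * (norm (z 0) + m * T)"
proof -
  let ?I = "{-T..T}"
  have "continuous_on ?I (\<lambda>s. norm (z s))"
  proof (intro continuous_on_norm continuous_at_imp_continuous_on ballI)
    show "isCont z s" if "s \<in> ?I" for s
      using D[of s] that has_vector_derivative_continuous by (auto simp: abs_le_iff)
  qed
  then obtain s0 where s0: "s0 \<in> ?I" "\<And>s. s \<in> ?I \<Longrightarrow> norm (z s) \<le> norm (z s0)"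
    using continuous_attains_sup[of ?I "\<lambda>s. norm (z s)"] T(1) by auto
  have "norm (z s0 - z 0) \<le> (L * norm (z s0) + m) * \<bar>s0 - 0\<bar>"
  proof (rule vector_derivative_bound[of ?I])
    fix s assume "s \<in> ?I"
    then have s: "\<bar>s\<bar> \<le> T" "norm (z s) \<le> norm (z s0)"
      using s0 by auto
    show "(z has_vector_derivative z' s) (at s)"
      using D s by simp
    show "norm (z' s) \<le> L * norm (z s0) + m"
      using B[OF s(1)] mult_left_mono[OF s(2) T(3)] by simp
  qed (use T s0 in auto)
  also have "\<dots> \<le> (L * norm (z s0) + m) * T"
  proof (rule mult_left_mono)
    \<comment> \<open>The sign of \<open>m\<close> is not prescribed, so the factor is seen to be
      nonnegative from the bound on \<open>z'\<close> at \<open>s0\<close>.\<close>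
    have "0 \<le> norm (z' s0)" by simp
    also have "\<dots> \<le> L * norm (z s0) + m"
      using B[of s0] s0(1) by auto
    finally show "0 \<le> L * norm (z s0) + m" .
  qed (use s0 in auto)
  also have "\<dots> = (L * T) * norm (z s0) + m * T"
    by (simp add: algebra_simps)
  also have "\<dots> \<le> (1/2) * norm (z s0) + m * T"
    using mult_right_mono[OF T(2) norm_ge_zero[of "z s0"]] by simp
  finally have "norm (z s0 - z 0) \<le> (1/2) * norm (z s0) + m * T" .
  moreover have "norm (z s0) \<le> norm (z 0) + norm (z s0 - z 0)"
    by (rule norm_triangle_sub)
  moreover have "norm (z s) \<le> norm (z s0)"
    using s s0(2)[of s] by (auto simp: abs_le_iff)
  ultimately show ?thesis
    by (simp add: field_simps)
qed

text \<open>
  The dyadic difference quotients are Cauchy, and their limit is linear. Applied to a flow, this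
  replaces solving the variational equation.
\<close>

lemma approx_linear_has_derivative:
  fixes G :: "'e::real_normed_vector \<Rightarrow> 'f::banach"
  assumes \<rho>: "0 < \<rho>" and C: "0 \<le> C"
    and quad: "\<And>a b h k. \<lbrakk>\<bar>a\<bar> \<le> 1; \<bar>b\<bar> \<le> 1; norm h < \<rho>; norm k < \<rho>; norm (a *\<^sub>R h + b *\<^sub>R k) < \<rho>\<rbrakk>
      \<Longrightarrow> norm (G (y + (a *\<^sub>R h + b *\<^sub>R k)) - G y - a *\<^sub>R (G (y + h) - G y) - b *\<^sub>R (G (y + k) - G y))
        \<le> C * (norm h + norm k)\<^sup>2"
    and lip: "\<And>h. norm h < \<rho> \<Longrightarrow> norm (G (y + h) - G y) \<le> K * norm h"
  shows "\<exists>D. (G has_derivative D) (at y) \<and>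
    (\<forall>h. (\<lambda>n. 2 ^ n *\<^sub>R (G (y + (1 / 2 ^ n) *\<^sub>R h) - G y)) \<longlonglongrightarrow> D h)"
proof -
  define g where "g h = G (y + h) - G y" for h
  define a where "a h n = 2 ^ n *\<^sub>R g ((1 / 2 ^ n) *\<^sub>R h)" for h and n :: nat
  have ga: "norm (g (c *\<^sub>R h + d *\<^sub>R k) - c *\<^sub>R g h - d *\<^sub>R g k) \<le> C * (norm h + norm k)\<^sup>2"
    if "\<bar>c\<bar> \<le> 1" "\<bar>d\<bar> \<le> 1" "norm h < \<rho>" "norm k < \<rho>" "norm (c *\<^sub>R h + d *\<^sub>R k) < \<rho>" for c d h k
    using quad[OF that] by (simp add: g_def)
  have small: "norm ((1 / 2 ^ n) *\<^sub>R h) < \<rho>" if h: "norm h < \<rho>" for h :: 'e and n :: nat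
  proof -
    have "(1 / 2 ^ n) * norm h \<le> 1 * norm h"
      by (rule mult_right_mono) (auto simp: field_simps)
    then show ?thesis
      using h by simp
  qed
  have step: "norm (a h (Suc n) - a h n) \<le> 2 * C * (norm h)\<^sup>2 * (1/2) ^ n" if h: "norm h < \<rho>" for h n
  proof -
    let ?h = "(1 / 2 ^ n) *\<^sub>R h"
    \<comment> \<open>The case of coefficients 1/2 and 0: halving the increment halves
      \<open>g\<close> up to a quadratic error.\<close>
    have "norm (g ((1/2) *\<^sub>R ?h + 0 *\<^sub>R 0) - (1/2) *\<^sub>R g ?h - 0 *\<^sub>R g 0) \<le> C * (norm ?h + norm (0::'e))\<^sup>2"
      by (rule ga) (use \<rho> small[OF h, of n] small[OF h, of "Suc n"] in auto)
    then have *: "norm (g ((1/2) *\<^sub>R ?h) - (1/2) *\<^sub>R g ?h) \<le> C * (norm ?h)\<^sup>2"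
      by simp
    have "a h (Suc n) - a h n = (2 * 2 ^ n) *\<^sub>R (g ((1/2) *\<^sub>R ?h) - (1/2) *\<^sub>R g ?h)"
      by (simp add: a_def algebra_simps)
    then have "norm (a h (Suc n) - a h n) = (2 * 2 ^ n) * norm (g ((1/2) *\<^sub>R ?h) - (1/2) *\<^sub>R g ?h)"
      by simp
    also have "\<dots> \<le> (2 * 2 ^ n) * (C * (norm ?h)\<^sup>2)"
      using * by (intro mult_left_mono) auto
    also have "\<dots> = 2 * C * (norm h)\<^sup>2 * (1/2) ^ n"
      by (simp add: field_simps power2_eq_square)
    finally show ?thesis .
  qed
  \<comment> \<open>The steps decay geometrically and sum to at most \<open>2 * C * 2\<close> times
    the squared norm. Hence the limit is quadratically close to \<open>a h 0 = g h\<close>, which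
    will be the remainder estimate for the derivative.\<close>
  have lim_small: "\<exists>l. a h \<longlonglongrightarrow> l \<and> norm (l - g h) \<le> 4 * C * (norm h)\<^sup>2" if h: "norm h < \<rho>" for h
  proof -
    let ?q = "\<lambda>n. 2 * C * (norm h)\<^sup>2 * (1/2::real) ^ n"
    have q: "?q sums (2 * C * (norm h)\<^sup>2 * 2)"
      by (rule sums_mult) (use geometric_sums[of "1/2::real"] in simp)
    have "summable (\<lambda>n. a h (Suc n) - a h n)"
      by (rule summable_comparison_test[OF _ sums_summable[OF q]]) (use step[OF h] in blast)
    then have "(\<lambda>n. \<Sum>i<n. a h (Suc i) - a h i) \<longlonglongrightarrow> (\<Sum>n. a h (Suc n) - a h n)"
      by (rule summable_LIMSEQ)
    then have "(\<lambda>n. a h n - a h 0) \<longlonglongrightarrow> (\<Sum>n. a h (Suc n) - a h n)"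
      by (simp add: sum_lessThan_telescope)
    from tendsto_add[OF this tendsto_const[of "a h 0"]]
    have "a h \<longlonglongrightarrow> (\<Sum>n. a h (Suc n) - a h n) + a h 0"
      by simp
    moreover have "norm (\<Sum>n. a h (Suc n) - a h n) \<le> (\<Sum>n. ?q n)"
      using step[OF h] sums_summable[OF q] by (rule norm_suminf_le)
    then have "norm (\<Sum>n. a h (Suc n) - a h n) \<le> 4 * C * (norm h)\<^sup>2"
      using sums_unique[OF q] by simp
    moreover have "a h 0 = g h"
      by (simp add: a_def)
    ultimately show ?thesis
      by (intro exI[of _ "(\<Sum>n. a h (Suc n) - a h n) + a h 0"]) simp
  qed
  have tiny: "\<forall>\<^sub>F n in sequentially. norm ((1 / 2 ^ n) *\<^sub>R h) < \<rho>" for h :: 'e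
  proof -
    have "(\<lambda>n. (1/2) ^ n * norm h) \<longlonglongrightarrow> 0 * norm h"
      by (intro tendsto_intros LIMSEQ_realpow_zero) auto
    then have "\<forall>\<^sub>F n in sequentially. (1/2) ^ n * norm h < \<rho>"
      using \<rho> by (intro order_tendstoD) auto
    then show ?thesis
      by (simp add: power_divide)
  qed
  \<comment> \<open>A long \<open>h\<close> is first shrunk by a power of 2, which merely shifts and
    rescales the sequence of quotients.\<close>
  have "\<exists>l. a h \<longlonglongrightarrow> l" for h
  proof -
    obtain m :: nat where m: "norm ((1 / 2 ^ m) *\<^sub>R h) < \<rho>"
      using tiny[of h] by (auto simp: eventually_sequentially)
    obtain l where "a ((1 / 2 ^ m) *\<^sub>R h) \<longlonglongrightarrow> l"
      using lim_small[OF m] by blast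
    then have "(\<lambda>n. 2 ^ m *\<^sub>R a ((1 / 2 ^ m) *\<^sub>R h) n) \<longlonglongrightarrow> 2 ^ m *\<^sub>R l"
      by (intro tendsto_intros)
    moreover have "2 ^ m *\<^sub>R a ((1 / 2 ^ m) *\<^sub>R h) n = a h (n + m)" for n
      by (simp add: a_def power_add mult.commute)
    ultimately have "(\<lambda>n. a h (n + m)) \<longlonglongrightarrow> 2 ^ m *\<^sub>R l"
      by simp
    then show ?thesis
      using LIMSEQ_offset by blast
  qed
  then obtain D where D: "a h \<longlonglongrightarrow> D h" for h
    by metis
  \<comment> \<open>The defect of linearity at scale \<open>1 / 2 ^ n\<close> is of order
    \<open>1 / 4 ^ n\<close>, and the difference quotient multiplies it by only
    \<open>2 ^ n\<close>.\<close>
  have comb: "D (c *\<^sub>R h + d *\<^sub>R k) = c *\<^sub>R D h + d *\<^sub>R D k" if cd: "\<bar>c\<bar> \<le> 1" "\<bar>d\<bar> \<le> 1" for c d h k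
  proof -
    let ?e = "\<lambda>n. a (c *\<^sub>R h + d *\<^sub>R k) n - c *\<^sub>R a h n - d *\<^sub>R a k n"
    have "\<forall>\<^sub>F n in sequentially. norm (?e n) \<le> C * (norm h + norm k)\<^sup>2 * (1/2) ^ n"
      using tiny[of h] tiny[of k] tiny[of "c *\<^sub>R h + d *\<^sub>R k"]
    proof eventually_elim
      case (elim n)
      let ?h = "(1 / 2 ^ n) *\<^sub>R h" and ?k = "(1 / 2 ^ n) *\<^sub>R k"
      have s: "(1 / 2 ^ n) *\<^sub>R (c *\<^sub>R h + d *\<^sub>R k) = c *\<^sub>R ?h + d *\<^sub>R ?k"
        by (simp add: scaleR_add_right)
      have "norm (?e n) = 2 ^ n * norm (g (c *\<^sub>R ?h + d *\<^sub>R ?k) - c *\<^sub>R g ?h - d *\<^sub>R g ?k)"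
      proof -
        have "?e n = 2 ^ n *\<^sub>R (g (c *\<^sub>R ?h + d *\<^sub>R ?k) - c *\<^sub>R g ?h - d *\<^sub>R g ?k)"
          unfolding a_def s by (simp only: scaleR_diff_right scaleR_left_commute)
        then show ?thesis
          by simp
      qed
      also have "\<dots> \<le> 2 ^ n * (C * (norm ?h + norm ?k)\<^sup>2)"
        by (intro mult_left_mono ga) (use elim cd s in auto)
      also have "\<dots> = C * (norm h + norm k)\<^sup>2 * (1/2) ^ n"
        by (simp add: field_simps power2_eq_square)
      finally show ?case .
    qed
    moreover have "(\<lambda>n. C * (norm h + norm k)\<^sup>2 * (1/2) ^ n) \<longlonglongrightarrow> 0"
      by (intro tendsto_mult_right_zero LIMSEQ_realpow_zero) auto
    ultimately have "?e \<longlonglongrightarrow> 0"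
      by (rule Lim_null_comparison)
    moreover have "?e \<longlonglongrightarrow> D (c *\<^sub>R h + d *\<^sub>R k) - c *\<^sub>R D h - d *\<^sub>R D k"
      by (intro tendsto_intros D)
    ultimately have "D (c *\<^sub>R h + d *\<^sub>R k) - c *\<^sub>R D h - d *\<^sub>R D k = 0"
      using LIMSEQ_unique by blast
    then show ?thesis
      by (simp add: algebra_simps)
  qed
  have scale1: "D (c *\<^sub>R h) = c *\<^sub>R D h" if "\<bar>c\<bar> \<le> 1" for c h
    using comb[OF that, of 0 h 0] by simp
  \<comment> \<open>Coefficients were restricted to absolute value at most 1; a larger factor is
    undone by its inverse.\<close>
  have scale: "D (c *\<^sub>R h) = c *\<^sub>R D h" for c h
  proof (cases "\<bar>c\<bar> \<le> 1")
    case False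
    then have "D ((1/c) *\<^sub>R (c *\<^sub>R h)) = (1/c) *\<^sub>R D (c *\<^sub>R h)"
      by (intro scale1) (simp add: divide_le_eq_1)
    moreover have "c \<noteq> 0"
      using False by auto
    ultimately have "D h = (1/c) *\<^sub>R D (c *\<^sub>R h)"
      by simp
    then show ?thesis
      using \<open>c \<noteq> 0\<close> by simp
  qed (rule scale1)
  \<comment> \<open>The Lipschitz bound passes to the limit and makes the linear map
    \<open>D\<close> bounded.\<close>
  have "norm (D h) \<le> norm h * K" for h
  proof (rule Lim_norm_ubound[OF _ D])
    show "\<forall>\<^sub>F n in sequentially. norm (a h n) \<le> norm h * K"
      using tiny[of h]
    proof eventually_elim
      case (elim n)
      have "norm (a h n) \<le> 2 ^ n * (K * norm ((1 / 2 ^ n) *\<^sub>R h))"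
        using mult_left_mono[OF lip[OF elim], of "2 ^ n"] by (simp add: a_def g_def)
      also have "\<dots> = norm h * K"
        by simp
      finally show ?case .
    qed
  qed simp
  then have "bounded_linear D"
    using comb[of 1 1] scale by (intro bounded_linear_intro[of D K]) auto
  moreover have "((\<lambda>h. norm (G (y + h) - G y - D h) / norm h) \<longlongrightarrow> 0) (at 0)"
  proof (rule Lim_null_comparison)
    have "\<forall>\<^sub>F h in at 0. norm h < \<rho>"
      using \<rho> by (auto simp: eventually_at dist_norm)
    then show "\<forall>\<^sub>F h in at 0. norm (norm (G (y + h) - G y - D h) / norm h) \<le> 4 * C * norm h"
    proof eventually_elim
      case (elim h)
      obtain l where l: "a h \<longlonglongrightarrow> l" "norm (l - g h) \<le> 4 * C * (norm h)\<^sup>2"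
        using lim_small[OF elim] by blast
      have "l = D h"
        using LIMSEQ_unique[OF l(1) D] .
      then have "norm (G (y + h) - G y - D h) \<le> 4 * C * norm h * norm h"
        using l(2) by (simp add: g_def norm_minus_commute power2_eq_square mult_ac)
      then show ?case
        using C by (cases "h = 0") (simp_all add: divide_le_eq)
    qed
    show "((\<lambda>h::'e. 4 * C * norm h) \<longlongrightarrow> 0) (at 0)"
      by (intro tendsto_mult_right_zero tendsto_norm_zero tendsto_ident_at)
  qed
  ultimately have "(G has_derivative D) (at y)"
    by (simp add: has_derivative_at)
  moreover have "a h = (\<lambda>n. 2 ^ n *\<^sub>R (G (y + (1 / 2 ^ n) *\<^sub>R h) - G y))" for h
    by (simp add: fun_eq_iff a_def g_def)
  ultimately show ?thesis
    using D by metis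
qed

subsection \<open>Local flows in the model space\<close>

lemma deriv_bound_imp_lipschitz:
  assumes "convex S" "\<And>x. x \<in> S \<Longrightarrow> (f has_derivative Df x) (at x)"
    "\<And>x h. x \<in> S \<Longrightarrow> norm (Df x h) \<le> L * norm h" "0 \<le> L" "x \<in> S" "y \<in> S"
  shows "norm (f x - f y) \<le> L * norm (x - y)"
proof (rule differentiable_bound[OF assms(1) _ _ assms(5,6)])
  show "(f has_derivative Df x) (at x within S)" if "x \<in> S" for x
    using assms(2) that has_derivative_at_withinI by blast
  show "onorm (Df x) \<le> L" if "x \<in> S" for x
    by (rule onorm_bound[OF assms(4) assms(3)[OF that]])
qed

text \<open>By continuity at \<open>x0\<close>, the finitely many first and second directional
  derivatives along a frame are bounded on a common ball. The bound on the second ones makes the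
  first ones Lipschitz by the mean value inequality. All later flow estimates rest on
  \<open>K\<close>, \<open>L\<close> and \<open>N\<close>.\<close>

lemma smooth_local_bounds:
  fixes f :: "'e::real_inner \<Rightarrow> 'f::real_normed_vector" and B :: "'e set"
  assumes "parseval B" "smooth_on S f" "open S" "x0 \<in> S"
  shows "\<exists>r K L N. 0 < r \<and> 0 \<le> K \<and> 0 \<le> L \<and> 0 \<le> N \<and> ball x0 r \<subseteq> S \<and>
    (\<forall>x\<in>ball x0 r. norm (f x) \<le> K \<and> (\<forall>h. norm (frechet_derivative f (at x) h) \<le> L * norm h)) \<and>
    (\<forall>x\<in>ball x0 r. \<forall>y\<in>ball x0 r. \<forall>h.
      norm (frechet_derivative f (at x) h - frechet_derivative f (at y) h) \<le> N * norm (x - y) * norm h)"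
proof -
  let ?D = "\<lambda>x. frechet_derivative f (at x)"
  let ?D2 = "\<lambda>b x. frechet_derivative (\<lambda>x. ?D x b) (at x)"
  have Ck: "Ck_on k S f" for k
    using assms(2) by (simp add: smooth_on_def)
  have Ck1: "Ck_on k S (\<lambda>x. ?D x b)" for k b
    using Ck[of "Suc k"] by simp
  have Ck2: "Ck_on k S (\<lambda>x. ?D2 b x b')" for k b b'
    using Ck1[of "Suc k"] by simp
  have d1: "(f has_derivative ?D x) (at x)" if "x \<in> S" for x
    using Ck_on_SucD[OF Ck that] .
  have d2: "((\<lambda>x. ?D x b) has_derivative ?D2 b x) (at x)" if "x \<in> S" for x b
    using Ck_on_SucD[OF Ck1 that] .
  have lin: "linear (?D x)" if "x \<in> S" for x
    using d1[OF that] by (rule has_derivative_linear)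
  have lin2: "linear (?D2 b x)" if "x \<in> S" for x b
    using d2[OF that] by (rule has_derivative_linear)
  have ev: "\<forall>\<^sub>F x in nhds x0. norm (g x) \<le> norm (g x0) + 1" if "Ck_on 0 S g" for g :: "'e \<Rightarrow> 'f"
  proof -
    have "isCont g x0"
      using that assms(3,4) by (simp add: continuous_on_eq_continuous_at)
    then have "((\<lambda>x. norm (g x)) \<longlongrightarrow> norm (g x0)) (nhds x0)"
      by (intro tendsto_norm) (simp add: isCont_def tendsto_at_iff_tendsto_nhds)
    then have "\<forall>\<^sub>F x in nhds x0. norm (g x) < norm (g x0) + 1"
      by (rule order_tendstoD) simp
    then show ?thesis
      by eventually_elim simp
  qed
  have finB: "finite B"
    using assms(1) by (simp add: parseval_def)
  define K where "K = norm (f x0) + 1"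
  define \<kappa> where "\<kappa> = (\<Sum>b\<in>B. norm b)"
  define l where "l = (\<Sum>b\<in>B. norm (?D x0 b) + 1)"
  define n where "n = (\<Sum>b\<in>B. \<Sum>b'\<in>B. norm (?D2 b x0 b') + 1)"
  have \<kappa>: "0 \<le> \<kappa>"
    by (simp add: \<kappa>_def sum_nonneg)
  have "\<forall>\<^sub>F x in nhds x0. x \<in> S \<and> norm (f x) \<le> K \<and> (\<forall>b\<in>B. norm (?D x b) \<le> norm (?D x0 b) + 1)
    \<and> (\<forall>b\<in>B. \<forall>b'\<in>B. norm (?D2 b x b') \<le> norm (?D2 b x0 b') + 1)"
    unfolding K_def
    by (intro eventually_conj eventually_ball_finite ballI finB ev Ck Ck1 Ck2
        eventually_nhds_in_open assms)
  then obtain r where r: "0 < r" and rb: "\<And>x. x \<in> ball x0 r \<Longrightarrow> x \<in> S \<and> norm (f x) \<le> K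
    \<and> (\<forall>b\<in>B. norm (?D x b) \<le> norm (?D x0 b) + 1)
    \<and> (\<forall>b\<in>B. \<forall>b'\<in>B. norm (?D2 b x b') \<le> norm (?D2 b x0 b') + 1)"
    by (auto simp: eventually_nhds_metric dist_commute)
  have l: "norm (?D x b) \<le> l" if "x \<in> ball x0 r" "b \<in> B" for x b
  proof -
    have "norm (?D x b) \<le> norm (?D x0 b) + 1"
      using rb that by blast
    also have "\<dots> \<le> l"
      unfolding l_def using that finB by (intro member_le_sum) auto
    finally show ?thesis .
  qed
  have n: "norm (?D2 b x b') \<le> n" if "x \<in> ball x0 r" "b \<in> B" "b' \<in> B" for x b b'
  proof -
    have "norm (?D2 b x b') \<le> norm (?D2 b x0 b') + 1"
      using rb that by blast
    also have "\<dots> \<le> (\<Sum>b'\<in>B. norm (?D2 b x0 b') + 1)"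
      using that finB by (intro member_le_sum[of b' B "\<lambda>b'. norm (?D2 b x0 b') + 1"]) auto
    also have "\<dots> \<le> n"
      unfolding n_def using that finB
      by (intro member_le_sum[of b B "\<lambda>b. \<Sum>b'\<in>B. norm (?D2 b x0 b') + 1"] sum_nonneg) auto
    finally show ?thesis .
  qed
  have Lb: "norm (?D x h) \<le> l * \<kappa> * norm h" if "x \<in> ball x0 r" for x h
    unfolding \<kappa>_def by (rule parseval_bound[OF assms(1)]) (use l lin rb that in auto)
  have ln: "0 \<le> l" "0 \<le> n"
    by (auto simp: l_def n_def intro!: sum_nonneg)
  have D2b: "onorm (?D2 b x) \<le> n * \<kappa>" if "x \<in> ball x0 r" "b \<in> B" for x b
  proof (rule onorm_bound)
    show "norm (?D2 b x h) \<le> n * \<kappa> * norm h" for h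
      unfolding \<kappa>_def by (rule parseval_bound[OF assms(1)]) (use n lin2 rb that in auto)
  qed (use ln \<kappa> in simp)
  have Nb: "norm (?D x h - ?D y h) \<le> (n * \<kappa> * \<kappa>) * norm (x - y) * norm h"
    if "x \<in> ball x0 r" "y \<in> ball x0 r" for x y h
  proof -
    have "norm (?D x b - ?D y b) \<le> n * \<kappa> * norm (x - y)" if "b \<in> B" for b
    proof (rule differentiable_bound[of "ball x0 r"])
      show "((\<lambda>x. ?D x b) has_derivative ?D2 b x) (at x within ball x0 r)" if "x \<in> ball x0 r" for x
        using d2 rb that has_derivative_at_withinI by blast
    qed (use D2b \<open>b \<in> B\<close> \<open>x \<in> ball x0 r\<close> \<open>y \<in> ball x0 r\<close> in auto)
    moreover have "linear (\<lambda>h. ?D x h - ?D y h)"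
      by (intro linear_compose_sub lin) (use rb that in auto)
    ultimately have "norm (?D x h - ?D y h) \<le> (n * \<kappa> * norm (x - y)) * \<kappa> * norm h"
      unfolding \<kappa>_def
      using parseval_bound[OF assms(1), of "\<lambda>h. ?D x h - ?D y h" "n * (\<Sum>b\<in>B. norm b) * norm (x - y)"] by blast
    then show ?thesis
      by (simp add: mult_ac)
  qed
  with ln r rb \<kappa> Lb Nb show ?thesis
    by (intro exI[of _ r] exI[of _ K] exI[of _ "l * \<kappa>"] exI[of _ "n * \<kappa> * \<kappa>"]) (auto simp: K_def)
qed

text \<open>Isolates what the estimates use of a flow seen in a chart. Curves start in the half ball
  and stay, up to time \<open>T\<close>, in the full ball where the bounds on \<open>f\<close> hold.
  \<open>Df_lip\<close> stands in for a bound on the second derivative, and \<open>small\<close> is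
  the condition of \<open>small_time_gronwall\<close>.\<close>

locale local_flow =
  fixes f :: "'e::banach \<Rightarrow> 'e" and Df :: "'e \<Rightarrow> 'e \<Rightarrow> 'e" and x0 :: 'e
    and r K L N T :: real and u :: "real \<Rightarrow> 'e \<Rightarrow> 'e"
  assumes nonneg: "0 < r" "0 \<le> K" "0 \<le> L" "0 \<le> N" "0 \<le> T"
    and small: "L * T \<le> 1/2"
    and f_bound: "\<And>x. x \<in> ball x0 r \<Longrightarrow> norm (f x) \<le> K"
    and f_deriv: "\<And>x. x \<in> ball x0 r \<Longrightarrow> (f has_derivative Df x) (at x)"
    and Df_bound: "\<And>x h. x \<in> ball x0 r \<Longrightarrow> norm (Df x h) \<le> L * norm h"
    and Df_lip: "\<And>x y h. x \<in> ball x0 r \<Longrightarrow> y \<in> ball x0 r \<Longrightarrow>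
      norm (Df x h - Df y h) \<le> N * norm (x - y) * norm h"
    and u_0: "\<And>y. y \<in> ball x0 (r/2) \<Longrightarrow> u 0 y = y"
    and u_deriv: "\<And>s y. y \<in> ball x0 (r/2) \<Longrightarrow> \<bar>s\<bar> \<le> T \<Longrightarrow>
      ((\<lambda>s. u s y) has_vector_derivative f (u s y)) (at s)"
    and u_ball: "\<And>s y. y \<in> ball x0 (r/2) \<Longrightarrow> \<bar>s\<bar> \<le> T \<Longrightarrow> u s y \<in> ball x0 r"
begin

lemma half_ball: "y \<in> ball x0 (r/2) \<Longrightarrow> y \<in> ball x0 r"
  using nonneg(1) by simp

lemma Df_linear: "x \<in> ball x0 r \<Longrightarrow> linear (Df x)"
  using f_deriv has_derivative_linear by blast

lemma f_lip:
  assumes "x \<in> ball x0 r" "y \<in> ball x0 r"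
  shows "norm (f x - f y) \<le> L * norm (x - y)"
  by (rule deriv_bound_imp_lipschitz[OF convex_ball f_deriv Df_bound nonneg(3) assms])

text \<open>On the segment from \<open>x\<close> to \<open>y\<close> the derivative differs from
  \<open>Df x\<close> by at most \<open>N * norm (y - x)\<close>. The mean value inequality then
  gives the constant \<open>N\<close>, cruder than \<open>N / 2\<close> but sufficient.\<close>

lemma f_taylor:
  assumes "x \<in> ball x0 r" "y \<in> ball x0 r"
  shows "norm (f y - f x - Df x (y - x)) \<le> N * (norm (y - x))\<^sup>2"
proof -
  let ?S = "closed_segment x y"
  have sub: "?S \<subseteq> ball x0 r"
    using assms by (simp add: closed_segment_subset)
  have "norm (f y - f x - Df x (y - x)) \<le> norm (y - x) * (N * norm (y - x))"
  proof (rule differentiable_bound_linearization[of x y ?S f Df x])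
    show "x + t *\<^sub>R (y - x) \<in> ?S" if "t \<in> {0..1}" for t
      using that by (auto simp: in_segment algebra_simps intro!: exI[of _ t])
    show "(f has_derivative Df w) (at w within ?S)" if "w \<in> ?S" for w
      using f_deriv that sub has_derivative_at_withinI by blast
    show "onorm (Df w - Df x) \<le> N * norm (y - x)" if w: "w \<in> ?S" for w
    proof (rule onorm_bound)
      fix h
      have "norm (Df w h - Df x h) \<le> N * norm (w - x) * norm h"
        using Df_lip w sub assms by blast
      also have "\<dots> \<le> N * norm (y - x) * norm h"
        using segment_bound(1)[OF w] nonneg by (intro mult_mono) auto
      finally show "norm ((Df w - Df x) h) \<le> N * norm (y - x) * norm h"
        by simp
    qed (use nonneg in simp)
  qed simp
  then show ?thesis
    by (simp add: power2_eq_square mult_ac)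
qed

text \<open>The difference of two solutions satisfies the Gronwall condition with
  \<open>m = 0\<close>; the factor 2 comes from there.\<close>

lemma u_lip:
  assumes "y \<in> ball x0 (r/2)" "y' \<in> ball x0 (r/2)" "\<bar>s\<bar> \<le> T"
  shows "norm (u s y - u s y') \<le> 2 * norm (y - y')"
proof -
  have "norm (u s y - u s y') \<le> 2 * (norm (u 0 y - u 0 y') + 0 * T)"
  proof (rule small_time_gronwall[of T L "\<lambda>s. u s y - u s y'"])
    fix s assume s: "\<bar>s\<bar> \<le> T"
    show "((\<lambda>s. u s y - u s y') has_vector_derivative f (u s y) - f (u s y')) (at s)"
      using assms s by (intro has_vector_derivative_diff u_deriv)
    show "norm (f (u s y) - f (u s y')) \<le> L * norm (u s y - u s y') + 0"
      using f_lip u_ball assms s by simp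
  qed (use nonneg small assms in auto)
  then show ?thesis
    using u_0 assms by simp
qed

lemma u_near:
  assumes "y \<in> ball x0 (r/2)" "\<bar>s\<bar> \<le> T"
  shows "norm (u s y - y) \<le> K * \<bar>s\<bar>"
proof -
  have "norm (u s y - u 0 y) \<le> K * \<bar>s - 0\<bar>"
  proof (rule vector_derivative_bound[of "{-T..T}"])
    fix s assume "s \<in> {-T..T}"
    then have s: "\<bar>s\<bar> \<le> T" by auto
    show "((\<lambda>s. u s y) has_vector_derivative f (u s y)) (at s)"
      by (rule u_deriv[OF assms(1) s])
    show "norm (f (u s y)) \<le> K"
      by (rule f_bound[OF u_ball[OF assms(1) s]])
  qed (use assms nonneg in auto)
  then show ?thesis
    using u_0 assms by simp
qed

text \<open>The velocity of the increment is compared with \<open>Df x0 h\<close>. There are three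
  errors: the Taylor remainder of \<open>f\<close> along the curve, the move of the base point of
  \<open>Df\<close> from \<open>x0\<close> to the curve, and the drift of the increment away from
  \<open>h\<close>. Integration in time contributes \<open>\<bar>s\<bar>\<close>. Only the first
  error is quadratic in \<open>h\<close> and disappears in the derivative.\<close>

lemma increment_bound:
  assumes "y \<in> ball x0 (r/2)" "y + h \<in> ball x0 (r/2)" "\<bar>s\<bar> \<le> T"
  shows "norm (u s (y + h) - u s y - h - s *\<^sub>R Df x0 h)
    \<le> \<bar>s\<bar> * (4 * N * norm h + 2 * N * (norm (y - x0) + K * \<bar>s\<bar>) + 2 * L\<^sup>2 * \<bar>s\<bar>) * norm h"
proof -
  let ?w = "\<lambda>s. u s (y + h) - u s y"
  let ?z = "\<lambda>s. ?w s - h - s *\<^sub>R Df x0 h"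
  let ?m = "(4 * N * norm h + 2 * N * (norm (y - x0) + K * \<bar>s\<bar>) + 2 * L\<^sup>2 * \<bar>s\<bar>) * norm h"
  have x0: "x0 \<in> ball x0 r"
    using nonneg by simp
  have w: "norm (?w t) \<le> 2 * norm h" if "\<bar>t\<bar> \<le> T" for t
    using u_lip[OF assms(2,1) that] by simp
  have dw: "(?w has_vector_derivative f (u t (y + h)) - f (u t y)) (at t)" if "\<bar>t\<bar> \<le> T" for t
    using assms that by (intro has_vector_derivative_diff u_deriv)
  have Lw: "norm (f (u t (y + h)) - f (u t y)) \<le> L * (2 * norm h)" if "\<bar>t\<bar> \<le> T" for t
    using f_lip[of "u t (y + h)" "u t y"] u_ball assms that mult_left_mono[OF w[OF that] nonneg(3)]
    by (meson order_trans)
  have wh: "norm (?w t - h) \<le> 2 * L * norm h * \<bar>t\<bar>" if "\<bar>t\<bar> \<le> T" for t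
  proof -
    have "norm (?w t - ?w 0) \<le> L * (2 * norm h) * \<bar>t - 0\<bar>"
      by (rule vector_derivative_bound[OF _ dw Lw, of "{-T..T}"]) (use that nonneg in auto)
    then show ?thesis
      using u_0 assms by (simp add: mult_ac)
  qed
  have "norm (?z s - ?z 0) \<le> ?m * \<bar>s - 0\<bar>"
  proof (rule vector_derivative_bound[of "{-\<bar>s\<bar>..\<bar>s\<bar>}"])
    fix t assume "t \<in> {-\<bar>s\<bar>..\<bar>s\<bar>}"
    then have ts: "\<bar>t\<bar> \<le> \<bar>s\<bar>" and t: "\<bar>t\<bar> \<le> T"
      using assms(3) by auto
    show "(?z has_vector_derivative f (u t (y + h)) - f (u t y) - Df x0 h) (at t)"
      by (rule derivative_eq_intros dw t refl | simp)+
    have b1: "u t y \<in> ball x0 r" "u t (y + h) \<in> ball x0 r"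
      using u_ball assms t by auto
    have 1: "norm (f (u t (y + h)) - f (u t y) - Df (u t y) (?w t)) \<le> 4 * N * norm h * norm h"
    proof -
      have "norm (f (u t (y + h)) - f (u t y) - Df (u t y) (?w t)) \<le> N * (norm (?w t))\<^sup>2"
        by (rule f_taylor[OF b1])
      also have "\<dots> \<le> N * (2 * norm h)\<^sup>2"
        using w[OF t] nonneg by (intro mult_left_mono power_mono) auto
      finally show ?thesis
        by (simp add: power2_eq_square mult_ac)
    qed
    have 2: "norm (Df (u t y) (?w t) - Df x0 (?w t)) \<le> 2 * N * (norm (y - x0) + K * \<bar>s\<bar>) * norm h"
    proof -
      have "norm (u t y - x0) \<le> norm (y - x0) + norm (u t y - y)"
        using norm_triangle_ineq[of "u t y - y" "y - x0"] by simp
      also have "\<dots> \<le> norm (y - x0) + K * \<bar>t\<bar>"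
        using u_near[OF assms(1) t] by simp
      also have "\<dots> \<le> norm (y - x0) + K * \<bar>s\<bar>"
        using mult_left_mono[OF ts nonneg(2)] by simp
      finally have "norm (u t y - x0) \<le> norm (y - x0) + K * \<bar>s\<bar>" .
      then have "N * norm (u t y - x0) * norm (?w t) \<le> N * (norm (y - x0) + K * \<bar>s\<bar>) * (2 * norm h)"
        using w[OF t] nonneg by (intro mult_mono) auto
      then show ?thesis
        using Df_lip[OF b1(1) x0, of "?w t"] by (simp add: mult_ac)
    qed
    have 3: "norm (Df x0 (?w t) - Df x0 h) \<le> 2 * L\<^sup>2 * \<bar>s\<bar> * norm h"
    proof -
      have "norm (Df x0 (?w t) - Df x0 h) \<le> L * norm (?w t - h)"
        using Df_bound[OF x0, of "?w t - h"] by (simp add: linear_diff[OF Df_linear[OF x0]])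
      also have "\<dots> \<le> L * (2 * L * norm h * \<bar>s\<bar>)"
        using wh[OF t] mult_left_mono[OF ts, of "2 * L * norm h"] nonneg by (intro mult_left_mono) auto
      finally show ?thesis
        by (simp add: power2_eq_square mult_ac)
    qed
    have "norm (f (u t (y + h)) - f (u t y) - Df x0 h)
      = norm ((f (u t (y + h)) - f (u t y) - Df (u t y) (?w t))
        + (Df (u t y) (?w t) - Df x0 (?w t)) + (Df x0 (?w t) - Df x0 h))"
      by simp
    also have "\<dots> \<le> norm (f (u t (y + h)) - f (u t y) - Df (u t y) (?w t))
        + norm (Df (u t y) (?w t) - Df x0 (?w t)) + norm (Df x0 (?w t) - Df x0 h)"
      by (intro order_trans[OF norm_triangle_ineq] add_right_mono norm_triangle_ineq)
    also have "\<dots> \<le> ?m"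
      using 1 2 3 by (simp add: algebra_simps)
    finally show "norm (f (u t (y + h)) - f (u t y) - Df x0 h) \<le> ?m" .
  qed auto
  moreover have "?z 0 = 0"
    using u_0 assms by simp
  ultimately have "norm (?z s) \<le> ?m * \<bar>s\<bar>"
    by (simp only: diff_zero)
  then show ?thesis
    by (simp only: mult_ac)
qed

text \<open>This is the hypothesis \<open>quad\<close> of
  \<open>approx_linear_has_derivative\<close>. Up to Taylor remainders all increments solve the same
  linear equation along \<open>u s y\<close>, so their defect of linearity obeys a Gronwall
  inequality with initial value 0. Each of the three remainders costs \<open>4 * N\<close> times the
  squared sum of norms, and Gronwall doubles the resulting 12.\<close>

lemma second_difference_bound:
  assumes "y \<in> ball x0 (r/2)" "y + h \<in> ball x0 (r/2)" "y + k \<in> ball x0 (r/2)"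
    "y + (a *\<^sub>R h + b *\<^sub>R k) \<in> ball x0 (r/2)" "\<bar>a\<bar> \<le> 1" "\<bar>b\<bar> \<le> 1" "\<bar>s\<bar> \<le> T"
  shows "norm (u s (y + (a *\<^sub>R h + b *\<^sub>R k)) - u s y - a *\<^sub>R (u s (y + h) - u s y) - b *\<^sub>R (u s (y + k) - u s y))
    \<le> 24 * N * T * (norm h + norm k)\<^sup>2"
proof -
  let ?l = "a *\<^sub>R h + b *\<^sub>R k"
  let ?w = "\<lambda>h s. u s (y + h) - u s y"
  let ?df = "\<lambda>h s. f (u s (y + h)) - f (u s y)"
  let ?z = "\<lambda>s. ?w ?l s - a *\<^sub>R ?w h s - b *\<^sub>R ?w k s"
  let ?q = "(norm h + norm k)\<^sup>2"
  have l: "norm ?l \<le> norm h + norm k"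
    using assms(5,6) mult_right_mono[OF assms(5), of "norm h"] mult_right_mono[OF assms(6), of "norm k"]
    by (intro order_trans[OF norm_triangle_ineq] add_mono) auto
  have dw: "(?w h has_vector_derivative ?df h t) (at t)"
    if "\<bar>t\<bar> \<le> T" "y + h \<in> ball x0 (r/2)" for t h
    using assms(1) that by (intro has_vector_derivative_diff u_deriv)
  have tay: "norm (?df h' t - Df (u t y) (?w h' t)) \<le> 4 * N * ?q"
    if "\<bar>t\<bar> \<le> T" "y + h' \<in> ball x0 (r/2)" "norm h' \<le> norm h + norm k" for t h'
  proof -
    have "norm (?df h' t - Df (u t y) (?w h' t)) \<le> N * (norm (?w h' t))\<^sup>2"
      using u_ball assms(1) that by (intro f_taylor) auto
    also have "\<dots> \<le> N * (2 * (norm h + norm k))\<^sup>2"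
      using u_lip[OF that(2) assms(1) that(1)] that(3) nonneg
      by (intro mult_left_mono power_mono) auto
    finally show ?thesis
      by (simp only: power_mult_distrib) simp
  qed
  have "norm (?z s) \<le> 2 * (norm (?z 0) + 12 * N * ?q * T)"
  proof (rule small_time_gronwall[of T L ?z])
    fix t assume t: "\<bar>t\<bar> \<le> T"
    let ?R = "\<lambda>h. ?df h t - Df (u t y) (?w h t)"
    have norm4: "norm (p - q - r + s) \<le> norm p + norm q + norm r + norm s" for p q r s :: 'e
      using norm_triangle_ineq[of "p - q - r" s] norm_triangle_ineq4[of "p - q" r] norm_triangle_ineq4[of p q]
      by linarith
    show "(?z has_vector_derivative ?df ?l t - a *\<^sub>R ?df h t - b *\<^sub>R ?df k t) (at t)"
      by (intro has_vector_derivative_diff dw t assms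
          bounded_linear.has_vector_derivative[OF bounded_linear_scaleR_right])
    have ub: "u t y \<in> ball x0 r"
      using u_ball assms t by auto
    have lin: "Df (u t y) (?z t) = Df (u t y) (?w ?l t) - a *\<^sub>R Df (u t y) (?w h t) - b *\<^sub>R Df (u t y) (?w k t)"
      by (simp only: linear_diff[OF Df_linear[OF ub]] linear_cmul[OF Df_linear[OF ub]])
    have eq: "?df ?l t - a *\<^sub>R ?df h t - b *\<^sub>R ?df k t = ?R ?l - a *\<^sub>R ?R h - b *\<^sub>R ?R k + Df (u t y) (?z t)"
      unfolding lin by (simp only: scaleR_diff_right) (simp only: algebra_simps)
    have "norm (?df ?l t - a *\<^sub>R ?df h t - b *\<^sub>R ?df k t)
      \<le> norm (?R ?l) + norm (a *\<^sub>R ?R h) + norm (b *\<^sub>R ?R k) + norm (Df (u t y) (?z t))"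
      unfolding eq by (rule norm4)
    also have "\<dots> \<le> 4 * N * ?q + 1 * (4 * N * ?q) + 1 * (4 * N * ?q) + L * norm (?z t)"
      unfolding norm_scaleR
      by (intro add_mono mult_mono tay Df_bound ub t assms l) (use nonneg in auto)
    finally show "norm (?df ?l t - a *\<^sub>R ?df h t - b *\<^sub>R ?df k t) \<le> L * norm (?z t) + 12 * N * ?q"
      by simp
  qed (use nonneg small assms in auto)
  then show ?thesis
    using u_0 assms(1-4) by (simp add: mult_ac)
qed

text \<open>The bound is the rescaled limit of \<open>increment_bound\<close> along
  \<open>h / 2 ^ n\<close>, where the term \<open>4 * N * norm h\<close> tends to 0. It refers to
  \<open>Df\<close> at the fixed centre \<open>x0\<close>, so that \<open>y\<close> may later move
  with \<open>t\<close>.\<close>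

lemma u_has_derivative:
  assumes "y \<in> ball x0 (r/2)" "\<bar>t\<bar> \<le> T"
  shows "\<exists>D. (u t has_derivative D) (at y) \<and>
    (\<forall>h. norm (D h - h - t *\<^sub>R Df x0 h)
      \<le> \<bar>t\<bar> * (2 * N * (norm (y - x0) + K * \<bar>t\<bar>) + 2 * L\<^sup>2 * \<bar>t\<bar>) * norm h)"
proof -
  define \<rho> where "\<rho> = r/2 - dist x0 y"
  have \<rho>: "0 < \<rho>"
    using assms(1) by (simp add: \<rho>_def)
  have inb: "y + h \<in> ball x0 (r/2)" if "norm h < \<rho>" for h
    using that dist_triangle[of x0 "y + h" y] dist_norm[of y "y + h"] by (simp add: \<rho>_def)
  obtain D where D: "(u t has_derivative D) (at y)"
    and lim: "\<And>h. (\<lambda>n. 2 ^ n *\<^sub>R (u t (y + (1 / 2 ^ n) *\<^sub>R h) - u t y)) \<longlonglongrightarrow> D h"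
    using approx_linear_has_derivative[of \<rho> "24 * N * T" "u t" y 2, OF \<rho>]
      second_difference_bound[OF assms(1) inb inb inb _ _ assms(2)]
      u_lip[OF inb assms(1) assms(2)] nonneg by auto
  have "norm (D h - h - t *\<^sub>R Df x0 h)
      \<le> \<bar>t\<bar> * (2 * N * (norm (y - x0) + K * \<bar>t\<bar>) + 2 * L\<^sup>2 * \<bar>t\<bar>) * norm h" for h
  proof (rule tendsto_le[OF sequentially_bot])
    have x0: "linear (Df x0)"
      using nonneg by (intro Df_linear) simp
    let ?h = "\<lambda>n. (1 / 2 ^ n) *\<^sub>R h"
    let ?e = "\<lambda>n. 2 ^ n *\<^sub>R (u t (y + ?h n) - u t y) - h - t *\<^sub>R Df x0 h"
    let ?m = "\<lambda>n. \<bar>t\<bar> * (4 * N * ((1/2) ^ n * norm h) + 2 * N * (norm (y - x0) + K * \<bar>t\<bar>) + 2 * L\<^sup>2 * \<bar>t\<bar>) * norm h"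
    show "(\<lambda>n. norm (?e n)) \<longlonglongrightarrow> norm (D h - h - t *\<^sub>R Df x0 h)"
      by (intro tendsto_intros lim)
    have p: "(\<lambda>n. (1/2::real) ^ n) \<longlonglongrightarrow> 0"
      by (rule LIMSEQ_realpow_zero) auto
    have "?m \<longlonglongrightarrow> \<bar>t\<bar> * (4 * N * (0 * norm h) + 2 * N * (norm (y - x0) + K * \<bar>t\<bar>) + 2 * L\<^sup>2 * \<bar>t\<bar>) * norm h"
      by (intro tendsto_intros p)
    then show "?m \<longlonglongrightarrow> \<bar>t\<bar> * (2 * N * (norm (y - x0) + K * \<bar>t\<bar>) + 2 * L\<^sup>2 * \<bar>t\<bar>) * norm h"
      by simp
    have "(\<lambda>n. (1/2) ^ n * norm h) \<longlonglongrightarrow> 0 * norm h"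
      by (intro tendsto_intros p)
    then have "\<forall>\<^sub>F n in sequentially. (1/2) ^ n * norm h < \<rho>"
      using \<rho> by (intro order_tendstoD) auto
    then show "\<forall>\<^sub>F n in sequentially. norm (?e n) \<le> ?m n"
    proof eventually_elim
      case (elim n)
      then have n: "norm (?h n) < \<rho>"
        by (simp add: power_divide)
      have "?e n = 2 ^ n *\<^sub>R (u t (y + ?h n) - u t y - ?h n - t *\<^sub>R Df x0 (?h n))"
        by (simp add: linear_cmul[OF x0] scaleR_diff_right scaleR_left_commute)
      then have "norm (?e n) = 2 ^ n * norm (u t (y + ?h n) - u t y - ?h n - t *\<^sub>R Df x0 (?h n))"
        by simp
      also have "\<dots> \<le> 2 ^ n * (\<bar>t\<bar> * (4 * N * norm (?h n) + 2 * N * (norm (y - x0) + K * \<bar>t\<bar>) + 2 * L\<^sup>2 * \<bar>t\<bar>) * norm (?h n))"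
        by (intro mult_left_mono increment_bound[OF assms(1) inb[OF n] assms(2)]) auto
      also have "\<dots> = ?m n"
        by (simp add: power_divide)
      finally show ?case .
    qed
  qed
  with D show ?thesis
    by blast
qed

end

subsection \<open>Atlases with differentiable transitions\<close>

lemma has_derivative_eventually_eq:
  assumes "(f has_derivative D) (at x)" "\<forall>\<^sub>F y in nhds x. f y = g y"
  shows "(g has_derivative D) (at x)"
proof -
  obtain S where "open S" "x \<in> S" "\<And>y. y \<in> S \<Longrightarrow> f y = g y"
    using assms(2) by (auto simp: eventually_nhds)
  then show ?thesis
    using has_derivative_transform_within_open[OF assms(1)] by blast
qed

lemma has_derivative_filterlim_nhds:
  assumes "(f has_derivative D) (at x)"
  shows "filterlim f (nhds (f x)) (nhds x)"
  using has_derivative_continuous[OF assms]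
  by (simp add: isCont_def tendsto_at_iff_tendsto_nhds)

lemma has_vector_derivative_compose_has_derivative:
  assumes "(\<gamma> has_vector_derivative v) (at t)" "(f has_derivative D) (at x)" "\<gamma> t = x"
  shows "((f \<circ> \<gamma>) has_vector_derivative D v) (at t)"
proof -
  have "((f \<circ> \<gamma>) has_derivative (D \<circ> (\<lambda>h. h *\<^sub>R v))) (at t)"
    using assms unfolding has_vector_derivative_def by (intro diff_chain_at) auto
  then show ?thesis
    using linear_cmul[OF has_derivative_linear[OF assms(2)]]
    by (simp add: has_vector_derivative_def o_def)
qed

abbreviation transition_deriv ::
  "('a, 'e::real_normed_vector) chart \<Rightarrow> ('a, 'e) chart \<Rightarrow> 'a \<Rightarrow> 'e \<Rightarrow> 'e" where
  "transition_deriv c d q \<equiv> frechet_derivative (snd d \<circ> chart_inv c) (at (snd c q))"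

lemma tangent_spaceI:
  assumes "\<And>c. \<not> (c \<in> A \<and> q \<in> fst c) \<Longrightarrow> v c = 0"
    and "\<And>c d. c \<in> A \<Longrightarrow> d \<in> A \<Longrightarrow> q \<in> fst c \<Longrightarrow> q \<in> fst d \<Longrightarrow> v d = transition_deriv c d q (v c)"
  shows "v \<in> tangent_space A q"
  unfolding tangent_space_def using assms by blast

lemma tangent_space_off:
  "v \<in> tangent_space A q \<Longrightarrow> \<not> (c \<in> A \<and> q \<in> fst c) \<Longrightarrow> v c = 0"
  unfolding tangent_space_def by blast

lemma tangent_space_transition:
  "v \<in> tangent_space A q \<Longrightarrow> c \<in> A \<Longrightarrow> d \<in> A \<Longrightarrow> q \<in> fst c \<Longrightarrow> q \<in> fst d \<Longrightarrow>
    v d = transition_deriv c d q (v c)"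
  unfolding tangent_space_def by blast

text \<open>
  Both the atlas of the base and the induced atlas of the cotangent bundle are of this kind; no
  topology on the total space of the bundle is needed.
\<close>

locale diff_atlas =
  fixes A :: "('a, 'e::real_normed_vector) chart set"
  assumes chart_inj: "c \<in> A \<Longrightarrow> inj_on (snd c) (fst c)"
    and open_overlap: "c \<in> A \<Longrightarrow> d \<in> A \<Longrightarrow> open (snd c ` (fst c \<inter> fst d))"
    and transition_differentiable: "c \<in> A \<Longrightarrow> d \<in> A \<Longrightarrow> q \<in> fst c \<Longrightarrow> q \<in> fst d \<Longrightarrow>
      (snd d \<circ> chart_inv c) differentiable (at (snd c q))"
begin

lemma chart_inv_chart: "c \<in> A \<Longrightarrow> q \<in> fst c \<Longrightarrow> chart_inv c (snd c q) = q"
  by (simp add: chart_inv_def chart_inj)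

lemma chart_inv_in: "x \<in> snd c ` fst c \<Longrightarrow> chart_inv c x \<in> fst c"
  by (simp add: chart_inv_def inv_into_into)

lemma chart_chart_inv: "x \<in> snd c ` fst c \<Longrightarrow> snd c (chart_inv c x) = x"
  by (simp add: chart_inv_def f_inv_into_f)

lemma open_chart: "c \<in> A \<Longrightarrow> open (snd c ` fst c)"
  using open_overlap[of c c] by simp

lemma carrierI: "c \<in> A \<Longrightarrow> q \<in> fst c \<Longrightarrow> q \<in> carrier_of A"
  by (auto simp: carrier_of_def)

lemma chart_at:
  assumes "q \<in> carrier_of A"
  shows "chart_at A q \<in> A" "q \<in> fst (chart_at A q)"
proof -
  have "\<exists>c. c \<in> A \<and> q \<in> fst c"
    using assms by (auto simp: carrier_of_def)
  then have "chart_at A q \<in> A \<and> q \<in> fst (chart_at A q)"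
    unfolding chart_at_def by (rule someI_ex)
  then show "chart_at A q \<in> A" "q \<in> fst (chart_at A q)"
    by auto
qed

lemma eventually_overlap:
  assumes "c \<in> A" "d \<in> A" "q \<in> fst c" "q \<in> fst d"
  shows "\<forall>\<^sub>F x in nhds (snd c q). x \<in> snd c ` fst c \<and> chart_inv c x \<in> fst c \<and> chart_inv c x \<in> fst d"
proof -
  have "\<forall>\<^sub>F x in nhds (snd c q). x \<in> snd c ` (fst c \<inter> fst d)"
    using assms open_overlap by (intro eventually_nhds_in_open) auto
  then show ?thesis
    by eventually_elim (use assms(1) in \<open>auto simp: chart_inv_chart\<close>)
qed

lemma transition_has_derivative:
  assumes "c \<in> A" "d \<in> A" "q \<in> fst c" "q \<in> fst d"
  shows "((snd d \<circ> chart_inv c) has_derivative transition_deriv c d q) (at (snd c q))"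
  using transition_differentiable[OF assms] frechet_derivative_works by blast

lemma transition_linear:
  assumes "c \<in> A" "d \<in> A" "q \<in> fst c" "q \<in> fst d"
  shows "linear (transition_deriv c d q)"
  using transition_has_derivative[OF assms] by (rule has_derivative_linear)

lemma transition_id:
  assumes "c \<in> A" "q \<in> fst c"
  shows "transition_deriv c c q u = u"
proof -
  have "((snd c \<circ> chart_inv c) has_derivative (\<lambda>u. u)) (at (snd c q))"
    using has_derivative_ident
  proof (rule has_derivative_eventually_eq)
    show "\<forall>\<^sub>F x in nhds (snd c q). x = (snd c \<circ> chart_inv c) x"
      using eventually_overlap[OF assms(1,1,2,2)] by eventually_elim (simp add: chart_chart_inv)
  qed
  then show ?thesis
    by (simp add: frechet_derivative_eqI)
qed

lemma transition_comp:
  assumes "c \<in> A" "d \<in> A" "e \<in> A" "q \<in> fst c" "q \<in> fst d" "q \<in> fst e"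
  shows "transition_deriv d e q (transition_deriv c d q u) = transition_deriv c e q u"
proof -
  have "((snd e \<circ> chart_inv d) has_derivative transition_deriv d e q) (at ((snd d \<circ> chart_inv c) (snd c q)))"
    using assms transition_has_derivative by (simp add: chart_inv_chart)
  then have "((snd e \<circ> chart_inv d) \<circ> (snd d \<circ> chart_inv c)
      has_derivative transition_deriv d e q \<circ> transition_deriv c d q) (at (snd c q))"
    by (rule diff_chain_at[OF transition_has_derivative[OF assms(1,2,4,5)]])
  then have "((snd e \<circ> chart_inv c) has_derivative transition_deriv d e q \<circ> transition_deriv c d q) (at (snd c q))"
  proof (rule has_derivative_eventually_eq)
    show "\<forall>\<^sub>F x in nhds (snd c q). ((snd e \<circ> chart_inv d) \<circ> (snd d \<circ> chart_inv c)) x = (snd e \<circ> chart_inv c) x"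
      using eventually_overlap[OF assms(1,2,4,5)] by eventually_elim (use assms in \<open>simp add: chart_inv_chart\<close>)
  qed
  then show ?thesis
    by (simp add: frechet_derivative_eqI)
qed

lemma coord_vector_tangent:
  assumes "c \<in> A" "q \<in> fst c"
  shows "coord_vector A c q u \<in> tangent_space A q"
  by (rule tangent_spaceI) (use assms in \<open>auto simp: coord_vector_def transition_comp\<close>)

lemma coord_vector_self:
  assumes "c \<in> A" "q \<in> fst c"
  shows "coord_vector A c q u c = u"
  using assms by (simp add: coord_vector_def transition_id)

lemma coord_vector_coords:
  assumes "c \<in> A" "q \<in> fst c" "v \<in> tangent_space A q"
  shows "coord_vector A c q (v c) = v"
proof
  show "coord_vector A c q (v c) d = v d" for d
    using tangent_space_off[OF assms(3), of d] tangent_space_transition[OF assms(3,1) _ assms(2), of d]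
    by (simp add: coord_vector_def)
qed

lemma tangent_space_add:
  assumes "v \<in> tangent_space A q" "w \<in> tangent_space A q"
  shows "(\<lambda>c. v c + w c) \<in> tangent_space A q"
proof (rule tangent_spaceI)
  fix c d assume "c \<in> A" "d \<in> A" "q \<in> fst c" "q \<in> fst d"
  then show "v d + w d = transition_deriv c d q (v c + w c)"
    using tangent_space_transition[OF assms(1), of c d] tangent_space_transition[OF assms(2), of c d]
    by (simp only: linear_add[OF transition_linear])
qed (use assms tangent_space_off in \<open>metis add_0\<close>)

lemma tangent_space_scale:
  assumes "v \<in> tangent_space A q"
  shows "(\<lambda>c. r *\<^sub>R v c) \<in> tangent_space A q"
proof (rule tangent_spaceI)
  fix c d assume "c \<in> A" "d \<in> A" "q \<in> fst c" "q \<in> fst d"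
  then show "r *\<^sub>R v d = transition_deriv c d q (r *\<^sub>R v c)"
    using tangent_space_transition[OF assms(1), of c d]
    by (simp only: linear_cmul[OF transition_linear])
qed (use assms tangent_space_off in \<open>metis scaleR_zero_right\<close>)

text \<open>Compatibility of the coordinate vectors need not be supplied: the curve stays in each
  chart near \<open>t\<close>, so its expressions in two charts differ by the transition map, and
  the chain rule applies.\<close>

lemma has_velocityI:
  assumes "\<gamma> t \<in> carrier_of A"
    and ev: "\<And>c. c \<in> A \<Longrightarrow> \<gamma> t \<in> fst c \<Longrightarrow> \<forall>\<^sub>F s in nhds t. \<gamma> s \<in> fst c"
    and D: "\<And>c. c \<in> A \<Longrightarrow> \<gamma> t \<in> fst c \<Longrightarrow> ((snd c \<circ> \<gamma>) has_vector_derivative v c) (at t)"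
    and z: "\<And>c. \<not> (c \<in> A \<and> \<gamma> t \<in> fst c) \<Longrightarrow> v c = 0"
  shows "has_velocity A \<gamma> t v"
proof -
  have "v d = transition_deriv c d (\<gamma> t) (v c)"
    if cd: "c \<in> A" "d \<in> A" "\<gamma> t \<in> fst c" "\<gamma> t \<in> fst d" for c d
  proof -
    have "(((snd d \<circ> chart_inv c) \<circ> (snd c \<circ> \<gamma>)) has_vector_derivative transition_deriv c d (\<gamma> t) (v c)) (at t)"
      by (rule has_vector_derivative_compose_has_derivative[OF D[OF cd(1,3)]
            transition_has_derivative[OF cd]]) simp
    moreover have "\<forall>\<^sub>F s in nhds t. ((snd d \<circ> chart_inv c) \<circ> (snd c \<circ> \<gamma>)) s = (snd d \<circ> \<gamma>) s"
      using ev[OF cd(1,3)] by eventually_elim (simp add: chart_inv_chart cd)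
    ultimately have "((snd d \<circ> \<gamma>) has_vector_derivative transition_deriv c d (\<gamma> t) (v c)) (at t)"
      unfolding has_vector_derivative_def by (rule has_derivative_eventually_eq)
    then show ?thesis
      by (rule vector_derivative_unique_at[OF D[OF cd(2,4)]])
  qed
  then have "v \<in> tangent_space A (\<gamma> t)"
    using z by (intro tangent_spaceI)
  with assms show ?thesis
    by (auto simp: has_velocity_def)
qed

lemma has_velocity_unique:
  assumes "has_velocity A \<gamma> t v" "has_velocity A \<gamma> t w"
  shows "v = w"
proof
  fix c
  show "v c = w c"
  proof (cases "c \<in> A \<and> \<gamma> t \<in> fst c")
    case True
    then show ?thesis
      using assms vector_derivative_unique_at unfolding has_velocity_def by blast
  next
    case False
    then show ?thesis
      using assms tangent_space_off unfolding has_velocity_def by metis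
  qed
qed

lemma velocity_eqI: "has_velocity A \<gamma> t v \<Longrightarrow> velocity A \<gamma> t = v"
  unfolding velocity_def using has_velocity_unique by blast

end

text \<open>The definition computes in the source chart picked by \<open>chart_at\<close>; the chain
  rule with transitions on both sides makes any pair of charts available. Condition
  \<open>ev\<close> keeps the values of \<open>F\<close> in the domain of \<open>d\<close>, away
  from junk values of its coordinate map.\<close>

lemma differential_eq:
  assumes "diff_atlas A" "diff_atlas B"
    and c: "c \<in> A" "q \<in> fst c" and d: "d \<in> B" "F q \<in> fst d"
    and ev: "\<forall>\<^sub>F x in nhds (snd c q). F (chart_inv c x) \<in> fst d"
    and D: "((snd d \<circ> F \<circ> chart_inv c) has_derivative D) (at (snd c q))"
    and v: "v \<in> tangent_space A q"
  shows "differential A B F q v = coord_vector B d (F q) (D (v c))"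
proof
  interpret A: diff_atlas A by fact
  interpret B: diff_atlas B by fact
  fix e
  define c' where "c' = chart_at A q"
  have c': "c' \<in> A" "q \<in> fst c'"
    using A.chart_at[OF A.carrierI[OF c]] by (auto simp: c'_def)
  show "differential A B F q v e = coord_vector B d (F q) (D (v c)) e"
  proof (cases "e \<in> B \<and> F q \<in> fst e")
    case True
    then have e: "e \<in> B" "F q \<in> fst e" by auto
    have t: "((snd c \<circ> chart_inv c') has_derivative transition_deriv c' c q) (at (snd c' q))"
      by (rule A.transition_has_derivative) (use c c' in auto)
    have tq: "(snd c \<circ> chart_inv c') (snd c' q) = snd c q"
      by (simp add: A.chart_inv_chart c')
    have "((snd d \<circ> F \<circ> chart_inv c) \<circ> (snd c \<circ> chart_inv c') has_derivative D \<circ> transition_deriv c' c q) (at (snd c' q))"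
      by (rule diff_chain_at[OF t]) (simp add: A.chart_inv_chart c' D[unfolded o_assoc])
    moreover have "((snd e \<circ> chart_inv d) has_derivative transition_deriv d e (F q))
        (at (((snd d \<circ> F \<circ> chart_inv c) \<circ> (snd c \<circ> chart_inv c')) (snd c' q)))"
      using B.transition_has_derivative[OF d(1) e(1) d(2) e(2)]
      by (simp add: A.chart_inv_chart c c')
    ultimately have "((snd e \<circ> chart_inv d) \<circ> ((snd d \<circ> F \<circ> chart_inv c) \<circ> (snd c \<circ> chart_inv c')) has_derivative
        transition_deriv d e (F q) \<circ> (D \<circ> transition_deriv c' c q)) (at (snd c' q))"
      by (rule diff_chain_at)
    moreover have "\<forall>\<^sub>F x in nhds (snd c' q).
      ((snd e \<circ> chart_inv d) \<circ> ((snd d \<circ> F \<circ> chart_inv c) \<circ> (snd c \<circ> chart_inv c'))) x = (snd e \<circ> F \<circ> chart_inv c') x"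
    proof -
      have "\<forall>\<^sub>F x in nhds (snd c' q). F (chart_inv c ((snd c \<circ> chart_inv c') x)) \<in> fst d"
        using filterlim_iff[THEN iffD1, OF has_derivative_filterlim_nhds[OF t]] ev unfolding tq by blast
      then show ?thesis
        using A.eventually_overlap[OF c'(1) c(1) c'(2) c(2)]
        by eventually_elim (simp add: A.chart_inv_chart B.chart_inv_chart c d)
    qed
    ultimately have "((snd e \<circ> F \<circ> chart_inv c') has_derivative
        transition_deriv d e (F q) \<circ> (D \<circ> transition_deriv c' c q)) (at (snd c' q))"
      by (rule has_derivative_eventually_eq)
    then have "frechet_derivative (snd e \<circ> F \<circ> chart_inv c') (at (snd c' q))
        = transition_deriv d e (F q) \<circ> (D \<circ> transition_deriv c' c q)"
      by (rule frechet_derivative_eqI)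
    moreover have "transition_deriv c' c q (v c') = v c"
      using tangent_space_transition[OF v c'(1) c(1) c'(2) c(2)] by simp
    ultimately show ?thesis
      using e by (simp add: differential_def coord_vector_def Let_def c'_def)
  qed (auto simp: differential_def coord_vector_def)
qed

locale manifold =
  fixes M :: "'a topology" and A :: "('a, 'e::{real_inner, banach}) chart set"
  assumes smooth_manifold: "smooth_manifold M A"
begin

lemma Hausdorff: "Hausdorff_space M"
  using smooth_manifold by (simp add: smooth_manifold_def)

lemma carrier_eq: "carrier_of A = topspace M"
  using smooth_manifold by (simp add: smooth_manifold_def carrier_of_def)

lemma openin_chart: "c \<in> A \<Longrightarrow> openin M (fst c)"
  using smooth_manifold by (simp add: smooth_manifold_def)

lemma chart_homeomorphic:
  "c \<in> A \<Longrightarrow> homeomorphic_map (subtopology M (fst c)) (top_of_set (snd c ` fst c)) (snd c)"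
  using smooth_manifold by (simp add: smooth_manifold_def)

lemma topspace_chart: "c \<in> A \<Longrightarrow> topspace (subtopology M (fst c)) = fst c"
  using openin_subset[OF openin_chart, of c] by auto

lemma open_chart_Int:
  assumes "c \<in> A" "openin M V"
  shows "open (snd c ` (fst c \<inter> V))"
proof -
  have "openin (subtopology M (fst c)) (fst c \<inter> V)"
    using assms(2) by (metis openin_subtopology_Int2)
  then have "openin (top_of_set (snd c ` fst c)) (snd c ` (fst c \<inter> V))"
    using homeomorphic_imp_open_map[OF chart_homeomorphic[OF assms(1)]] by (simp add: open_map_def)
  moreover have "open (snd c ` fst c)"
    using smooth_manifold assms(1) by (simp add: smooth_manifold_def)
  ultimately show ?thesis
    by (rule openin_open_trans)
qed

lemma openin_chart_preimage:
  assumes "c \<in> A" "open W"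
  shows "openin M {q \<in> fst c. snd c q \<in> W}"
proof -
  have "openin (top_of_set (snd c ` fst c)) (snd c ` fst c \<inter> W)"
    using assms(2) by (simp add: openin_open_Int)
  then have "openin (subtopology M (fst c)) {q \<in> topspace (subtopology M (fst c)). snd c q \<in> snd c ` fst c \<inter> W}"
    using homeomorphic_imp_continuous_map[OF chart_homeomorphic[OF assms(1)]]
    by (intro openin_continuous_map_preimage)
  moreover have "{q \<in> topspace (subtopology M (fst c)). snd c q \<in> snd c ` fst c \<inter> W} = {q \<in> fst c. snd c q \<in> W}"
    using topspace_chart[OF assms(1)] by auto
  ultimately show ?thesis
    using openin_chart[OF assms(1)] by (simp add: openin_trans_full)
qed

lemma transition_smooth:
  "c \<in> A \<Longrightarrow> d \<in> A \<Longrightarrow> smooth_on (snd c ` (fst c \<inter> fst d)) (snd d \<circ> chart_inv c)"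
  using smooth_manifold by (simp add: smooth_manifold_def)

sublocale diff_atlas A
proof
  show "inj_on (snd c) (fst c)" if "c \<in> A" for c
    using homeomorphic_imp_injective_map[OF chart_homeomorphic[OF that]] topspace_chart[OF that] by simp
  show "open (snd c ` (fst c \<inter> fst d))" if "c \<in> A" "d \<in> A" for c d
    using that openin_chart open_chart_Int by blast
  show "(snd d \<circ> chart_inv c) differentiable (at (snd c q))"
    if "c \<in> A" "d \<in> A" "q \<in> fst c" "q \<in> fst d" for c d q
  proof -
    have "Ck_on (Suc 0) (snd c ` (fst c \<inter> fst d)) (snd d \<circ> chart_inv c)"
      using transition_smooth[OF that(1,2)] unfolding smooth_on_def by blast
    then show ?thesis
      using that by auto
  qed
qed

lemma parseval_exists_model: "\<exists>B::'e set. parseval B"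
  using smooth_manifold parseval_exists by (auto simp: smooth_manifold_def)

end

subsection \<open>The flow of a complete vector field\<close>

locale complete_field = manifold M A
  for M :: "'a topology" and A :: "('a, 'e::{real_inner, banach}) chart set" +
  fixes X :: "'a \<Rightarrow> (('a, 'e) chart \<Rightarrow> 'e)"
  assumes X_smooth: "smooth_vector_field A X"
    and X_complete: "complete_vector_field A X"
begin

abbreviation X_rep :: "('a, 'e) chart \<Rightarrow> 'e \<Rightarrow> 'e" where
  "X_rep c x \<equiv> X (chart_inv c x) c"

lemma X_tangent: "q \<in> carrier_of A \<Longrightarrow> X q \<in> tangent_space A q"
  using X_smooth by (simp add: smooth_vector_field_def)

lemma X_rep_Ck: "c \<in> A \<Longrightarrow> Ck_on k (snd c ` fst c) (X_rep c)"
  using X_smooth by (simp add: smooth_vector_field_def smooth_on_def)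

lemma X_rep_has_derivative:
  assumes "c \<in> A" "x \<in> snd c ` fst c"
  shows "(X_rep c has_derivative frechet_derivative (X_rep c) (at x)) (at x)"
  by (rule Ck_on_SucD[OF X_rep_Ck assms(2)]) fact

lemma X_rep_bounds:
  assumes "c \<in> A" "q \<in> fst c"
  obtains r K L N where "0 < r" "0 \<le> K" "0 \<le> L" "0 \<le> N" "ball (snd c q) r \<subseteq> snd c ` fst c"
    "\<And>x. x \<in> ball (snd c q) r \<Longrightarrow> norm (X_rep c x) \<le> K"
    "\<And>x h. x \<in> ball (snd c q) r \<Longrightarrow> norm (frechet_derivative (X_rep c) (at x) h) \<le> L * norm h"
    "\<And>x y h. x \<in> ball (snd c q) r \<Longrightarrow> y \<in> ball (snd c q) r \<Longrightarrow>
      norm (frechet_derivative (X_rep c) (at x) h - frechet_derivative (X_rep c) (at y) h)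
        \<le> N * norm (x - y) * norm h"
proof -
  obtain B :: "'e set" where B: "parseval B"
    using parseval_exists_model by blast
  have "smooth_on (snd c ` fst c) (X_rep c)" "snd c q \<in> snd c ` fst c"
    using X_rep_Ck assms by (auto simp: smooth_on_def)
  from smooth_local_bounds[OF B this(1) open_chart[OF assms(1)] this(2)] show ?thesis
    using that by blast
qed

section \<open>Continuity and uniqueness of integral curves\<close>

abbreviation integral_curve :: "(real \<Rightarrow> 'a) \<Rightarrow> bool" where
  "integral_curve \<equiv> global_integral_curve A X"

lemma integral_curve_carrier: "integral_curve \<gamma> \<Longrightarrow> \<gamma> t \<in> carrier_of A"
  by (simp add: global_integral_curve_def has_velocity_def)

lemma integral_curve_chart:
  assumes "integral_curve \<gamma>" "c \<in> A" "\<gamma> t \<in> fst c"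
  shows "\<forall>\<^sub>F s in nhds t. \<gamma> s \<in> fst c"
    and "((\<lambda>s. snd c (\<gamma> s)) has_vector_derivative X_rep c (snd c (\<gamma> t))) (at t)"
  using assms by (auto simp: global_integral_curve_def has_velocity_def o_def chart_inv_chart)

text \<open>Velocities are expressed through charts alone. Continuity for the topology of
  \<open>M\<close> follows because charts carry open sets to open sets and are injective on their
  domains.\<close>

lemma integral_curve_continuous:
  assumes "integral_curve \<gamma>" "openin M V" "\<gamma> t \<in> V"
  shows "\<forall>\<^sub>F s in nhds t. \<gamma> s \<in> V"
proof -
  obtain c where c: "c \<in> A" "\<gamma> t \<in> fst c"
    using integral_curve_carrier[OF assms(1), of t] by (auto simp: carrier_of_def)
  have "isCont (\<lambda>s. snd c (\<gamma> s)) t"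
    using integral_curve_chart(2)[OF assms(1) c] by (rule has_vector_derivative_continuous)
  then have "((\<lambda>s. snd c (\<gamma> s)) \<longlongrightarrow> snd c (\<gamma> t)) (nhds t)"
    by (simp add: isCont_def tendsto_at_iff_tendsto_nhds[of "\<lambda>s. snd c (\<gamma> s)"])
  then have "\<forall>\<^sub>F s in nhds t. snd c (\<gamma> s) \<in> snd c ` (fst c \<inter> V)"
    using open_chart_Int[OF c(1) assms(2)] c(2) assms(3) by (intro topological_tendstoD) auto
  then show ?thesis
    using integral_curve_chart(1)[OF assms(1) c]
    by eventually_elim (use chart_inj[OF c(1)] in \<open>auto simp: inj_on_def\<close>)
qed

lemma integral_curve_open:
  assumes "integral_curve \<gamma>" "openin M V"
  shows "open {s. \<gamma> s \<in> V}"
proof (subst open_subopen, rule ballI)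
  fix t assume "t \<in> {s. \<gamma> s \<in> V}"
  then show "\<exists>T. open T \<and> t \<in> T \<and> T \<subseteq> {s. \<gamma> s \<in> V}"
    using integral_curve_continuous[OF assms, of t] unfolding eventually_nhds by blast
qed

lemma integral_curve_shift:
  assumes "integral_curve \<gamma>"
  shows "integral_curve (\<lambda>s. \<gamma> (s + a))"
  unfolding global_integral_curve_def
proof
  fix t
  have v: "X (\<gamma> (t + a)) \<in> tangent_space A (\<gamma> (t + a))"
    by (rule X_tangent[OF integral_curve_carrier[OF assms]])
  have "\<forall>\<^sub>F s in nhds t. \<gamma> (s + a) \<in> fst c" and
    "((snd c \<circ> (\<lambda>s. \<gamma> (s + a))) has_vector_derivative X (\<gamma> (t + a)) c) (at t)"
    if c: "c \<in> A" "\<gamma> (t + a) \<in> fst c" for c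
  proof -
    have "filterlim (\<lambda>s. s + a) (nhds (t + a)) (nhds t)"
      by (intro tendsto_intros filterlim_ident)
    then show "\<forall>\<^sub>F s in nhds t. \<gamma> (s + a) \<in> fst c"
      using integral_curve_chart(1)[OF assms c] eventually_compose_filterlim by blast
    have "((\<lambda>s. s + a) has_vector_derivative 1) (at t)"
      by (auto intro!: derivative_eq_intros)
    from vector_diff_chain_at[OF this integral_curve_chart(2)[OF assms c]]
    show "((snd c \<circ> (\<lambda>s. \<gamma> (s + a))) has_vector_derivative X (\<gamma> (t + a)) c) (at t)"
      using c by (simp add: o_def chart_inv_chart)
  qed
  then show "has_velocity A (\<lambda>s. \<gamma> (s + a)) t (X (\<gamma> (t + a)))"
    using v integral_curve_carrier[OF assms] by (simp add: has_velocity_def)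
qed

text \<open>Near \<open>t\<close> both curves lie in one chart and solve a Lipschitz equation there;
  Gronwall with \<open>m = 0\<close> and zero initial distance keeps them together.\<close>

lemma integral_curve_locally_unique:
  assumes "integral_curve \<gamma>1" "integral_curve \<gamma>2" "\<gamma>1 t = \<gamma>2 t"
  shows "\<forall>\<^sub>F s in nhds t. \<gamma>1 s = \<gamma>2 s"
proof -
  obtain c where c: "c \<in> A" "\<gamma>1 t \<in> fst c"
    using integral_curve_carrier[OF assms(1), of t] by (auto simp: carrier_of_def)
  let ?x0 = "snd c (\<gamma>1 t)"
  obtain r K L N where r: "0 < r" and L: "0 \<le> L" and sub: "ball ?x0 r \<subseteq> snd c ` fst c"
    and Lb: "\<And>x h. x \<in> ball ?x0 r \<Longrightarrow> norm (frechet_derivative (X_rep c) (at x) h) \<le> L * norm h"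
    using X_rep_bounds[OF c] by metis
  let ?V = "{q \<in> fst c. snd c q \<in> ball ?x0 r}"
  have V: "openin M ?V"
    by (rule openin_chart_preimage[OF c(1) open_ball])
  have in_V: "\<gamma>1 t \<in> ?V" "\<gamma>2 t \<in> ?V"
    using c r assms(3) by auto
  have "\<forall>\<^sub>F s in nhds t. \<gamma>1 s \<in> ?V \<and> \<gamma>2 s \<in> ?V"
    using integral_curve_continuous[OF assms(1) V in_V(1)] integral_curve_continuous[OF assms(2) V in_V(2)]
    by (rule eventually_conj)
  then obtain \<delta> where \<delta>: "0 < \<delta>" "\<And>s. dist s t < \<delta> \<Longrightarrow> \<gamma>1 s \<in> ?V \<and> \<gamma>2 s \<in> ?V"
    unfolding eventually_nhds_metric by blast
  \<comment> \<open>Half of \<open>\<delta>\<close> leaves room for the closed time interval; the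
    other entry ensures \<open>L * T \<le> 1/2\<close>, with \<open>L + 1\<close> to avoid dividing
    by 0.\<close>
  define T where "T = min (\<delta> / 2) (1 / (2 * (L + 1)))"
  have T: "0 < T" "T < \<delta>" "L * T \<le> 1/2"
  proof -
    show "0 < T" "T < \<delta>"
      using \<delta>(1) L by (auto simp: T_def)
    have "L * T \<le> L * (1 / (2 * (L + 1)))"
      using L by (intro mult_left_mono) (auto simp: T_def)
    also have "\<dots> \<le> 1/2"
      using L by (simp add: field_simps)
    finally show "L * T \<le> 1/2" .
  qed
  have "\<gamma>1 s = \<gamma>2 s" if s: "dist s t < T" for s
  proof -
    let ?z = "\<lambda>s. snd c (\<gamma>1 (s + t)) - snd c (\<gamma>2 (s + t))"
    have inV: "\<gamma>1 (a + t) \<in> ?V" "\<gamma>2 (a + t) \<in> ?V" if "\<bar>a\<bar> \<le> T" for a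
      using \<delta>(2)[of "a + t"] that T by (auto simp: dist_norm)
    have "norm (?z (s - t)) \<le> 2 * (norm (?z 0) + 0 * T)"
    proof (rule small_time_gronwall[of T L ?z])
      fix a assume "\<bar>a\<bar> \<le> T"
      then have a: "\<gamma>1 (a + t) \<in> fst c" "\<gamma>2 (a + t) \<in> fst c"
        "snd c (\<gamma>1 (a + t)) \<in> ball ?x0 r" "snd c (\<gamma>2 (a + t)) \<in> ball ?x0 r"
        using inV by auto
      show "(?z has_vector_derivative X_rep c (snd c (\<gamma>1 (a + t))) - X_rep c (snd c (\<gamma>2 (a + t)))) (at a)"
        by (intro has_vector_derivative_diff
            integral_curve_chart(2)[OF integral_curve_shift[OF assms(1)] c(1)]
            integral_curve_chart(2)[OF integral_curve_shift[OF assms(2)] c(1)] a)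
      have "norm (X_rep c (snd c (\<gamma>1 (a + t))) - X_rep c (snd c (\<gamma>2 (a + t)))) \<le> L * norm (?z a)"
        by (rule deriv_bound_imp_lipschitz[OF convex_ball X_rep_has_derivative[OF c(1)] Lb L a(3,4)])
          (use sub in auto)
      then show "norm (X_rep c (snd c (\<gamma>1 (a + t))) - X_rep c (snd c (\<gamma>2 (a + t)))) \<le> L * norm (?z a) + 0"
        by simp
    qed (use T L s in \<open>auto simp: dist_norm\<close>)
    then have "snd c (\<gamma>1 s) = snd c (\<gamma>2 s)"
      using assms(3) by simp
    moreover have "\<gamma>1 s \<in> fst c" "\<gamma>2 s \<in> fst c"
      using \<delta>(2)[of s] s T by auto
    ultimately show ?thesis
      using chart_inj[OF c(1)] by (auto simp: inj_on_def)
  qed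
  with T(1) show ?thesis
    unfolding eventually_nhds_metric by blast
qed

text \<open>The set of times of agreement is open by local uniqueness and closed by the Hausdorff
  property, and the real line is connected.\<close>

lemma integral_curve_unique:
  assumes "integral_curve \<gamma>1" "integral_curve \<gamma>2" "\<gamma>1 0 = \<gamma>2 0"
  shows "\<gamma>1 = \<gamma>2"
proof -
  let ?E = "{s. \<gamma>1 s = \<gamma>2 s}" and ?N = "{s. \<gamma>1 s \<noteq> \<gamma>2 s}"
  have "open ?E"
  proof (subst open_subopen, rule ballI)
    fix t assume "t \<in> ?E"
    then show "\<exists>T. open T \<and> t \<in> T \<and> T \<subseteq> ?E"
      using integral_curve_locally_unique[OF assms(1,2), of t] unfolding eventually_nhds by blast
  qed
  moreover have "open ?N"
  proof (subst open_subopen, rule ballI)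
    fix t assume "t \<in> ?N"
    moreover have "\<gamma>1 t \<in> topspace M" "\<gamma>2 t \<in> topspace M"
      using integral_curve_carrier assms carrier_eq by blast+
    ultimately obtain U V where UV: "openin M U" "openin M V" "\<gamma>1 t \<in> U" "\<gamma>2 t \<in> V" "disjnt U V"
      using Hausdorff unfolding Hausdorff_space_def by blast
    then have "open ({s. \<gamma>1 s \<in> U} \<inter> {s. \<gamma>2 s \<in> V})"
      using assms integral_curve_open by (intro open_Int) auto
    moreover have "{s. \<gamma>1 s \<in> U} \<inter> {s. \<gamma>2 s \<in> V} \<subseteq> ?N"
      using UV(5) by (auto simp: disjnt_iff)
    ultimately show "\<exists>T. open T \<and> t \<in> T \<and> T \<subseteq> ?N"
      using UV(3,4) by blast
  qed
  moreover have "?E \<inter> ?N \<inter> UNIV = {}" "UNIV \<subseteq> ?E \<union> ?N"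
    by auto
  moreover have "connected (UNIV :: real set)"
    by (rule connected_UNIV)
  ultimately have "?E \<inter> UNIV = {} \<or> ?N \<inter> UNIV = {}"
    unfolding connected_def by blast
  then show ?thesis
    using assms(3) by auto
qed

section \<open>The flow as a one-parameter group\<close>

lemma flow_eq: "integral_curve \<gamma> \<Longrightarrow> \<gamma> 0 = q \<Longrightarrow> flow_of A X t q = \<gamma> t"
  unfolding flow_of_def using integral_curve_unique
  by (subst the_equality[of _ \<gamma>]) auto

lemma flow_curve:
  assumes "q \<in> carrier_of A"
  shows "integral_curve (\<lambda>t. flow_of A X t q)" "flow_of A X 0 q = q"
proof -
  obtain \<gamma> where \<gamma>: "integral_curve \<gamma>" "\<gamma> 0 = q"
    using X_complete assms by (auto simp: complete_vector_field_def)
  then show "integral_curve (\<lambda>t. flow_of A X t q)" "flow_of A X 0 q = q"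
    by (simp_all add: flow_eq[OF \<gamma>])
qed

lemma flow_carrier: "q \<in> carrier_of A \<Longrightarrow> flow_of A X t q \<in> carrier_of A"
  by (rule integral_curve_carrier[OF flow_curve(1)])

lemma flow_add:
  assumes "q \<in> carrier_of A"
  shows "flow_of A X s (flow_of A X t q) = flow_of A X (s + t) q"
  by (rule flow_eq[OF integral_curve_shift[OF flow_curve(1)[OF assms]]]) simp

text \<open>Connects the \<open>inv_into\<close> in the definition of \<open>cotangent_lift\<close>
  with the flow at the opposite time, to which the flow estimates apply.\<close>

lemma inv_flow:
  assumes "q \<in> carrier_of A"
  shows "inv_into (carrier_of A) (flow_of A X t) q = flow_of A X (- t) q"
proof (rule inv_into_f_eq)
  show "inj_on (flow_of A X t) (carrier_of A)"
  proof (rule inj_on_inverseI)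
    show "flow_of A X (- t) (flow_of A X t p) = p" if "p \<in> carrier_of A" for p
      using that by (simp add: flow_add flow_curve)
  qed
qed (use assms in \<open>simp_all add: flow_carrier flow_add flow_curve\<close>)

text \<open>
  At the first exit time the curve would have a limit in the coordinate ball, by completeness of the
  model space, which by the Hausdorff property is its value.
\<close>

lemma integral_curve_trapped:
  assumes \<gamma>: "integral_curve \<gamma>" and c: "c \<in> A" "\<gamma> 0 \<in> fst c"
    and r: "0 < r" "snd c (\<gamma> 0) \<in> ball x0 (r/2)" "ball x0 r \<subseteq> snd c ` fst c"
    and K: "0 \<le> K" "\<And>x. x \<in> ball x0 r \<Longrightarrow> norm (X_rep c x) \<le> K"
    and T: "K * T \<le> r/4" "\<bar>s\<bar> \<le> T"
  shows "\<gamma> s \<in> fst c \<and> snd c (\<gamma> s) \<in> ball x0 r"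
proof (rule ccontr)
  assume notin: "\<not> (\<gamma> s \<in> fst c \<and> snd c (\<gamma> s) \<in> ball x0 r)"
  define V where "V = {q \<in> fst c. snd c q \<in> ball x0 r}"
  have V: "openin M V"
    unfolding V_def by (rule openin_chart_preimage[OF c(1) open_ball])
  define u where "u s = snd c (\<gamma> s)" for s
  \<comment> \<open>The bad times form a compact set, so one of them is nearest to 0; at all times
    strictly nearer to 0, of either sign, the curve is in \<open>V\<close>.\<close>
  let ?bad = "{-T..T} - {s. \<gamma> s \<in> V}"
  have "compact ?bad"
    by (intro compact_diff compact_Icc integral_curve_open[OF \<gamma> V])
  moreover have "s \<in> ?bad"
    using notin T(2) by (auto simp: V_def)
  moreover have "continuous_on ?bad (\<lambda>s. \<bar>s\<bar>)"
    by (intro continuous_intros)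
  ultimately obtain s0 where s0: "s0 \<in> ?bad" "\<And>s. s \<in> ?bad \<Longrightarrow> \<bar>s0\<bar> \<le> \<bar>s\<bar>"
    using continuous_attains_inf[of ?bad "\<lambda>s. \<bar>s\<bar>"] by blast
  have "dist x0 (snd c (\<gamma> 0)) < r"
    using r(1,2) by simp
  then have "\<gamma> 0 \<in> V"
    using c by (simp add: V_def)
  then have "s0 \<noteq> 0"
    using s0(1) by auto
  let ?I = "{-\<bar>s0\<bar><..<\<bar>s0\<bar>}"
  have good: "\<gamma> s \<in> V" if "s \<in> ?I" for s
    using s0(1) s0(2)[of s] that by fastforce
  have lip: "norm (u a - u b) \<le> K * \<bar>a - b\<bar>" if "a \<in> ?I" "b \<in> ?I" for a b
  proof (rule vector_derivative_bound[OF _ _ _ that])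
    show "(u has_vector_derivative X_rep c (u s)) (at s)" if "s \<in> ?I" for s
      unfolding u_def using good[OF that] by (intro integral_curve_chart \<gamma> c) (simp add: V_def)
    show "norm (X_rep c (u s)) \<le> K" if "s \<in> ?I" for s
      using good[OF that] by (intro K) (simp add: V_def u_def)
  qed auto
  \<comment> \<open>Times approaching \<open>s0\<close> from the side of 0, whatever the sign of
    \<open>s0\<close>.\<close>
  define t where "t n = s0 * (1 - inverse (real (Suc n)))" for n
  have t_lim: "t \<longlonglongrightarrow> s0"
  proof -
    have "t \<longlonglongrightarrow> s0 * (1 - 0)"
      unfolding t_def by (intro tendsto_intros LIMSEQ_inverse_real_of_nat)
    then show ?thesis by simp
  qed
  have t_in: "t n \<in> ?I" for n
  proof -
    have "\<bar>t n\<bar> = \<bar>s0\<bar> * (1 - inverse (real (Suc n)))"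
      unfolding t_def abs_mult by (simp add: field_simps)
    also have "\<dots> < \<bar>s0\<bar> * 1"
      using \<open>s0 \<noteq> 0\<close> by (intro mult_strict_left_mono) auto
    finally show ?thesis
      by (simp add: abs_less_iff)
  qed
  have "K-lipschitz_on ?I u"
    using lip K(1) by (intro lipschitz_onI) (auto simp: dist_norm)
  then have "Cauchy (\<lambda>n. u (t n))"
    using lipschitz_on_uniformly_continuous uniformly_continuous_on_Cauchy[of ?I u t]
      LIMSEQ_imp_Cauchy[OF t_lim] t_in by blast
  then obtain y where y: "(\<lambda>n. u (t n)) \<longlonglongrightarrow> y"
    using Cauchy_convergent_iff convergent_def by blast
  have "norm (y - u 0) \<le> r / 4"
  proof (rule Lim_norm_ubound[of sequentially "\<lambda>n. u (t n) - u 0"])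
    show "(\<lambda>n. u (t n) - u 0) \<longlonglongrightarrow> y - u 0"
      by (intro tendsto_intros y)
    have "norm (u (t n) - u 0) \<le> r / 4" for n
    proof -
      have "norm (u (t n) - u 0) \<le> K * \<bar>t n - 0\<bar>"
        using \<open>s0 \<noteq> 0\<close> by (intro lip t_in) auto
      also have "\<dots> \<le> K * T"
        using t_in[of n] s0(1) by (intro mult_left_mono K) auto
      finally show ?thesis
        using T(1) by simp
    qed
    then show "\<forall>\<^sub>F n in sequentially. norm (u (t n) - u 0) \<le> r / 4"
      by simp
  qed simp
  \<comment> \<open>The start is within \<open>r/2\<close> of \<open>x0\<close> and the limit within
    \<open>r/4\<close> of the start, which leaves a margin of \<open>r/4\<close>.\<close>
  then have yb: "y \<in> ball x0 r"
    using r(1,2) dist_triangle[of x0 y "u 0"] by (simp add: u_def dist_norm norm_minus_commute)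
  then have yin: "y \<in> snd c ` fst c"
    using r(3) by auto
  then have q': "chart_inv c y \<in> V"
    using yb by (simp add: V_def chart_inv_in chart_chart_inv)
  have "\<gamma> s0 = chart_inv c y"
  proof (rule ccontr)
    assume "\<gamma> s0 \<noteq> chart_inv c y"
    moreover have "\<gamma> s0 \<in> topspace M" "chart_inv c y \<in> topspace M"
      using integral_curve_carrier[OF \<gamma>] carrier_eq openin_subset[OF V] q' by auto
    ultimately obtain U1 U2 where U: "openin M U1" "openin M U2" "\<gamma> s0 \<in> U1" "chart_inv c y \<in> U2" "disjnt U1 U2"
      using Hausdorff unfolding Hausdorff_space_def by blast
    have "\<forall>\<^sub>F n in sequentially. \<gamma> (t n) \<in> U1"
      using integral_curve_continuous[OF \<gamma> U(1,3)] t_lim by (rule eventually_compose_filterlim)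
    moreover have "\<forall>\<^sub>F n in sequentially. u (t n) \<in> snd c ` (fst c \<inter> U2)"
    proof (rule topological_tendstoD[OF y open_chart_Int[OF c(1) U(2)]])
      show "y \<in> snd c ` (fst c \<inter> U2)"
        using U(4) q' chart_chart_inv[OF yin] by (intro image_eqI[of _ _ "chart_inv c y"]) (auto simp: V_def)
    qed
    ultimately have "\<forall>\<^sub>F n in sequentially. False"
    proof eventually_elim
      case (elim n)
      then have "\<gamma> (t n) \<in> U2"
        using good[OF t_in[of n]] chart_inj[OF c(1)] by (auto simp: V_def u_def inj_on_def)
      with elim(1) U(5) show ?case
        by (auto simp: disjnt_iff)
    qed
    then show False
      by simp
  qed
  with q' s0(1) show False
    by simp
qed

text \<open>Brings a complete field into the setting of \<open>local_flow\<close>. The confinement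
  of the curves is \<open>integral_curve_trapped\<close>, applied to every starting point in the
  half ball with the same \<open>T\<close>.\<close>

lemma flow_local:
  assumes c: "c \<in> A" "q \<in> fst c"
  obtains r K L N T where "0 < T" "ball (snd c q) r \<subseteq> snd c ` fst c"
    "local_flow (X_rep c) (\<lambda>x. frechet_derivative (X_rep c) (at x)) (snd c q) r K L N T
      (\<lambda>s y. snd c (flow_of A X s (chart_inv c y)))"
    "\<And>s y. y \<in> ball (snd c q) (r/2) \<Longrightarrow> \<bar>s\<bar> \<le> T \<Longrightarrow> flow_of A X s (chart_inv c y) \<in> fst c"
proof -
  let ?x0 = "snd c q"
  obtain r K L N where rK: "0 < r" "0 \<le> K" "0 \<le> L" "0 \<le> N" "ball ?x0 r \<subseteq> snd c ` fst c"
    and b: "\<And>x. x \<in> ball ?x0 r \<Longrightarrow> norm (X_rep c x) \<le> K"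
    "\<And>x h. x \<in> ball ?x0 r \<Longrightarrow> norm (frechet_derivative (X_rep c) (at x) h) \<le> L * norm h"
    "\<And>x y h. x \<in> ball ?x0 r \<Longrightarrow> y \<in> ball ?x0 r \<Longrightarrow>
      norm (frechet_derivative (X_rep c) (at x) h - frechet_derivative (X_rep c) (at y) h)
        \<le> N * norm (x - y) * norm h"
    using X_rep_bounds[OF c] by metis
  \<comment> \<open>The first entry limits the displacement \<open>K * T\<close> to
    \<open>r/4\<close> for \<open>integral_curve_trapped\<close>, the second is for
    Gronwall.\<close>
  define T where "T = min (r / (4 * (K + 1))) (1 / (2 * (L + 1)))"
  have T: "0 < T"
    using rK by (simp add: T_def)
  have LT: "L * T \<le> 1/2"
  proof -
    have "L * T \<le> L * (1 / (2 * (L + 1)))"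
      using rK by (intro mult_left_mono) (auto simp: T_def)
    also have "\<dots> \<le> 1/2"
      using rK by (simp add: field_simps)
    finally show ?thesis .
  qed
  have KT: "K * T \<le> r/4"
  proof -
    have "K * T \<le> K * (r / (4 * (K + 1)))"
      using rK by (intro mult_left_mono) (auto simp: T_def)
    also have "\<dots> \<le> r/4"
      using rK by (simp add: field_simps)
    finally show ?thesis .
  qed
  have half: "y \<in> snd c ` fst c" if "y \<in> ball ?x0 (r/2)" for y
    using that rK(1,5) by (auto simp: subset_iff)
  have carrier: "chart_inv c y \<in> carrier_of A" if "y \<in> ball ?x0 (r/2)" for y
    using chart_inv_in[OF half[OF that]] by (rule carrierI[OF c(1)])
  have trap: "flow_of A X s (chart_inv c y) \<in> fst c \<and> snd c (flow_of A X s (chart_inv c y)) \<in> ball ?x0 r"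
    if y: "y \<in> ball ?x0 (r/2)" and s: "\<bar>s\<bar> \<le> T" for s y
    by (rule integral_curve_trapped[OF flow_curve(1)[OF carrier[OF y]] c(1) _ rK(1) _ rK(5) rK(2) b(1) KT s])
      (use y carrier[OF y] half[OF y] in \<open>simp_all add: flow_curve chart_inv_in chart_chart_inv\<close>)
  have "local_flow (X_rep c) (\<lambda>x. frechet_derivative (X_rep c) (at x)) ?x0 r K L N T
      (\<lambda>s y. snd c (flow_of A X s (chart_inv c y)))"
  proof
    show "((\<lambda>s. snd c (flow_of A X s (chart_inv c y))) has_vector_derivative
        X_rep c (snd c (flow_of A X s (chart_inv c y)))) (at s)"
      if "y \<in> ball ?x0 (r/2)" "\<bar>s\<bar> \<le> T" for s y
      using trap[OF that] by (intro integral_curve_chart flow_curve carrier that c) auto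
    show "(X_rep c has_derivative frechet_derivative (X_rep c) (at x)) (at x)" if "x \<in> ball ?x0 r" for x
      using that rK(5) by (intro X_rep_has_derivative c) auto
  qed (use rK T LT b trap carrier half in \<open>simp_all add: flow_curve chart_chart_inv\<close>)
  with that T rK(5) trap show ?thesis
    by blast
qed

end

subsection \<open>The cotangent bundle\<close>

text \<open>Inverse to the fibre part of \<open>cotangent_chart\<close>. The value 0 off the tangent
  space is the normalisation of \<open>cotangent_space\<close>, so that covectors can be compared as
  functions.\<close>

definition coord_covector ::
  "('a, 'e::real_inner) chart set \<Rightarrow> ('a, 'e) chart \<Rightarrow> 'a \<Rightarrow> 'e \<Rightarrow> (('a, 'e) chart \<Rightarrow> 'e) \<Rightarrow> real" where
  "coord_covector A c q \<xi> = (\<lambda>v. if v \<in> tangent_space A q then \<xi> \<bullet> v c else 0)"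

lemma function_differential_eq:
  assumes "chart_at A q = c" "((H \<circ> chart_inv c) has_derivative D) (at (snd c q))"
  shows "function_differential A H q v = D (v c)"
  using assms by (simp add: function_differential_def frechet_derivative_eqI)

context manifold
begin

definition frame :: "'e set" where
  "frame = (SOME B. parseval B)"

lemma parseval_frame: "parseval frame"
  unfolding frame_def using parseval_exists_model by (rule someI_ex)

abbreviation cot_chart :: "('a, 'e) chart \<Rightarrow> (('a, 'e) covector, 'e \<times> 'e) chart" where
  "cot_chart \<equiv> cotangent_chart A"

text \<open>The transpose of a linear \<open>g\<close>, as a finite sum over the frame, so that when
  \<open>g\<close> depends on a parameter it can be differentiated term by term.\<close>

definition frame_adjoint :: "('e \<Rightarrow> 'e) \<Rightarrow> 'e \<Rightarrow> 'e" where
  "frame_adjoint g \<xi> = (\<Sum>b\<in>frame. (\<xi> \<bullet> g b) *\<^sub>R b)"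

lemma frame_adjoint_inner:
  assumes "linear g"
  shows "frame_adjoint g \<xi> \<bullet> u = \<xi> \<bullet> g u"
proof -
  have "linear (\<lambda>u. \<xi> \<bullet> g u)"
    by (rule linearI) (simp_all add: linear_add[OF assms] linear_cmul[OF assms] inner_add_right)
  from parseval_riesz[OF parseval_frame this] show ?thesis
    by (simp add: frame_adjoint_def)
qed

lemma cotangent_space_add:
  "p \<in> cotangent_space A q \<Longrightarrow> v \<in> tangent_space A q \<Longrightarrow> w \<in> tangent_space A q \<Longrightarrow>
    p (\<lambda>c. v c + w c) = p v + p w"
  by (simp add: cotangent_space_def)

lemma cotangent_space_scale:
  "p \<in> cotangent_space A q \<Longrightarrow> v \<in> tangent_space A q \<Longrightarrow> p (\<lambda>c. r *\<^sub>R v c) = r * p v"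
  by (simp add: cotangent_space_def)

lemma cotangent_space_off:
  "p \<in> cotangent_space A q \<Longrightarrow> v \<notin> tangent_space A q \<Longrightarrow> p v = 0"
  by (simp add: cotangent_space_def)

lemma coord_covector_in: "coord_covector A c q \<xi> \<in> cotangent_space A q"
proof -
  have "(\<lambda>c. r *\<^sub>R v c) \<notin> tangent_space A q" if "v \<notin> tangent_space A q" "r \<noteq> 0"
    for r and v :: "('a, 'e) chart \<Rightarrow> 'e"
    using tangent_space_scale[of "\<lambda>c. r *\<^sub>R v c" q "inverse r"] that by auto
  then show ?thesis
    by (auto simp: cotangent_space_def coord_covector_def tangent_space_add tangent_space_scale
        inner_add_right)
qed

lemma coord_vector_linear:
  assumes "c \<in> A" "q \<in> fst c"
  shows "coord_vector A c q (u + w) = (\<lambda>d. coord_vector A c q u d + coord_vector A c q w d)"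
    "coord_vector A c q (r *\<^sub>R u) = (\<lambda>d. r *\<^sub>R coord_vector A c q u d)"
proof -
  note lin = transition_linear[OF assms(1) _ assms(2)]
  show "coord_vector A c q (u + w) = (\<lambda>d. coord_vector A c q u d + coord_vector A c q w d)"
    unfolding coord_vector_def by (rule ext) (simp add: linear_add[OF lin])
  show "coord_vector A c q (r *\<^sub>R u) = (\<lambda>d. r *\<^sub>R coord_vector A c q u d)"
    unfolding coord_vector_def by (rule ext) (simp add: linear_cmul[OF lin])
qed

lemma coord_covector_coord_vector:
  assumes "c \<in> A" "q \<in> fst c"
  shows "coord_covector A c q \<xi> (coord_vector A c q u) = \<xi> \<bullet> u"
  using assms by (simp add: coord_covector_def coord_vector_tangent coord_vector_self)

text \<open>Riesz representation of the functional that \<open>p\<close> induces on coordinate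
  vectors in the chart \<open>c\<close>.\<close>

lemma coord_covector_exists:
  assumes "c \<in> A" "q \<in> fst c" "p \<in> cotangent_space A q"
  shows "\<exists>\<xi>. p = coord_covector A c q \<xi>"
proof -
  let ?g = "\<lambda>u. p (coord_vector A c q u)"
  have "linear ?g"
    using assms
    by (intro linearI) (simp_all add: coord_vector_linear cotangent_space_add cotangent_space_scale coord_vector_tangent)
  then have g: "(\<Sum>b\<in>frame. ?g b *\<^sub>R b) \<bullet> u = ?g u" for u
    using parseval_riesz[OF parseval_frame] by blast
  have "p v = coord_covector A c q (\<Sum>b\<in>frame. ?g b *\<^sub>R b) v" for v
  proof (cases "v \<in> tangent_space A q")
    case True
    then show ?thesis
      by (simp only: coord_covector_def g coord_vector_coords[OF assms(1,2)] if_True)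
  next
    case False
    then show ?thesis
      using cotangent_space_off[OF assms(3)] by (simp add: coord_covector_def)
  qed
  then show ?thesis
    by blast
qed

lemma coord_covector_inject:
  assumes "c \<in> A" "q \<in> fst c"
  shows "coord_covector A c q \<xi> = coord_covector A c q \<eta> \<longleftrightarrow> \<xi> = \<eta>"
proof
  assume "coord_covector A c q \<xi> = coord_covector A c q \<eta>"
  then have "\<xi> \<bullet> u = \<eta> \<bullet> u" for u
    using coord_covector_coord_vector[OF assms] by metis
  from this[of "\<xi> - \<eta>"] have "(\<xi> - \<eta>) \<bullet> (\<xi> - \<eta>) = 0"
    by (simp add: inner_diff_left)
  then show "\<xi> = \<eta>"
    by simp
qed simp

text \<open>Covectors are contravariant: their coordinates change by the transpose of the
  differential of the transition in the opposite direction.\<close>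

lemma coord_covector_transition:
  assumes "c \<in> A" "d \<in> A" "q \<in> fst c" "q \<in> fst d"
  shows "coord_covector A c q \<xi> = coord_covector A d q (frame_adjoint (transition_deriv d c q) \<xi>)"
proof
  show "coord_covector A c q \<xi> v = coord_covector A d q (frame_adjoint (transition_deriv d c q) \<xi>) v" for v
    using tangent_space_transition[of v A q d c] assms
    by (simp add: coord_covector_def frame_adjoint_inner[OF transition_linear])
qed

section \<open>Charts and transitions of the cotangent bundle\<close>

lemma fst_cot_chart: "fst (cot_chart c) = (SIGMA q:fst c. cotangent_space A q)"
  by (simp add: cotangent_chart_def)

lemma coord_covector_mem: "q \<in> fst c \<Longrightarrow> (q, coord_covector A c' q \<xi>) \<in> fst (cot_chart c)"
  by (simp add: fst_cot_chart coord_covector_in)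

lemma cot_chart_cases:
  assumes "c \<in> A" "z \<in> fst (cot_chart c)"
  obtains q \<xi> where "q \<in> fst c" "z = (q, coord_covector A c q \<xi>)"
  using assms(2) coord_covector_exists[OF assms(1)] that by (auto simp: fst_cot_chart)

lemma snd_cot_chart:
  assumes "c \<in> A" "q \<in> fst c"
  shows "snd (cot_chart c) (q, coord_covector A c q \<xi>) = (snd c q, \<xi>)"
proof -
  have "(THE \<eta>. \<forall>v\<in>tangent_space A q. coord_covector A c q \<xi> v = \<eta> \<bullet> v c) = \<xi>"
  proof (rule the_equality)
    fix \<eta> assume "\<forall>v\<in>tangent_space A q. coord_covector A c q \<xi> v = \<eta> \<bullet> v c"
    then have "coord_covector A c q \<xi> = coord_covector A c q \<eta>"
      by (auto simp: coord_covector_def)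
    then show "\<eta> = \<xi>"
      by (simp add: coord_covector_inject[OF assms])
  qed (simp add: coord_covector_def)
  then show ?thesis
    by (simp add: cotangent_chart_def)
qed

lemma cot_chart_inj: "c \<in> A \<Longrightarrow> inj_on (snd (cot_chart c)) (fst (cot_chart c))"
proof (rule inj_onI)
  fix z w assume c: "c \<in> A" and zw: "z \<in> fst (cot_chart c)" "w \<in> fst (cot_chart c)"
    and eq: "snd (cot_chart c) z = snd (cot_chart c) w"
  obtain q \<xi> where z: "q \<in> fst c" "z = (q, coord_covector A c q \<xi>)"
    using cot_chart_cases[OF c zw(1)] .
  obtain q' \<xi>' where w: "q' \<in> fst c" "w = (q', coord_covector A c q' \<xi>')"
    using cot_chart_cases[OF c zw(2)] .
  show "z = w"
    using eq z w chart_inj[OF c] by (auto simp: snd_cot_chart[OF c] inj_on_def)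
qed

text \<open>The fibre over \<open>q\<close> is the same set for every chart around \<open>q\<close>,
  so overlaps are full cylinders.\<close>

lemma cot_chart_overlap_image:
  assumes "c \<in> A" "d \<in> A"
  shows "snd (cot_chart c) ` (fst (cot_chart c) \<inter> fst (cot_chart d)) = snd c ` (fst c \<inter> fst d) \<times> UNIV"
proof (intro set_eqI iffI)
  fix y assume "y \<in> snd (cot_chart c) ` (fst (cot_chart c) \<inter> fst (cot_chart d))"
  then obtain z where z: "z \<in> fst (cot_chart c)" "z \<in> fst (cot_chart d)" "y = snd (cot_chart c) z"
    by auto
  then obtain q \<xi> where "q \<in> fst c" "z = (q, coord_covector A c q \<xi>)"
    using cot_chart_cases[OF assms(1)] by blast
  with z show "y \<in> snd c ` (fst c \<inter> fst d) \<times> UNIV"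
    by (auto simp: snd_cot_chart[OF assms(1)] fst_cot_chart)
next
  fix y assume "y \<in> snd c ` (fst c \<inter> fst d) \<times> (UNIV :: 'e set)"
  then obtain q \<xi> where "q \<in> fst c" "q \<in> fst d" "y = (snd c q, \<xi>)"
    by auto
  then show "y \<in> snd (cot_chart c) ` (fst (cot_chart c) \<inter> fst (cot_chart d))"
    by (intro image_eqI[of _ _ "(q, coord_covector A c q \<xi>)"])
      (auto simp: snd_cot_chart[OF assms(1)] coord_covector_mem)
qed

lemma cot_chart_image: "c \<in> A \<Longrightarrow> snd (cot_chart c) ` fst (cot_chart c) = snd c ` fst c \<times> UNIV"
  using cot_chart_overlap_image[of c c] by simp

lemma cot_chart_inv:
  assumes "c \<in> A" "x \<in> snd c ` fst c"
  shows "chart_inv (cot_chart c) (x, \<xi>) = (chart_inv c x, coord_covector A c (chart_inv c x) \<xi>)"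
proof -
  let ?z = "(chart_inv c x, coord_covector A c (chart_inv c x) \<xi>)"
  have "snd (cot_chart c) ?z = (x, \<xi>)"
    using assms by (simp add: snd_cot_chart chart_inv_in chart_chart_inv)
  moreover have "?z \<in> fst (cot_chart c)"
    by (rule coord_covector_mem[OF chart_inv_in[OF assms(2)]])
  ultimately show ?thesis
    unfolding chart_inv_def[of "cot_chart c"] by (intro inv_into_f_eq cot_chart_inj[OF assms(1)])
qed

lemma cot_transition:
  assumes "c \<in> A" "d \<in> A" "q \<in> fst c" "q \<in> fst d"
  shows "(snd (cot_chart d) \<circ> chart_inv (cot_chart c)) (snd c q, \<xi>)
    = (snd d q, frame_adjoint (transition_deriv d c q) \<xi>)"
proof -
  have "chart_inv (cot_chart c) (snd c q, \<xi>) = (q, coord_covector A c q \<xi>)"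
    using assms by (simp add: cot_chart_inv chart_inv_chart)
  also have "coord_covector A c q \<xi> = coord_covector A d q (frame_adjoint (transition_deriv d c q) \<xi>)"
    by (rule coord_covector_transition[OF assms])
  finally show ?thesis
    by (simp only: o_apply snd_cot_chart[OF assms(2,4)])
qed

lemma frame_adjoint_has_derivative:
  assumes "\<And>b. b \<in> frame \<Longrightarrow> ((\<lambda>x. g x b) has_derivative g' b) (at (fst z))"
  shows "((\<lambda>z. frame_adjoint (g (fst z)) (snd z)) has_derivative
    (\<lambda>h. \<Sum>b\<in>frame. (snd z \<bullet> g' b (fst h) + snd h \<bullet> g (fst z) b) *\<^sub>R b)) (at z)"
proof -
  have "((\<lambda>z. g (fst z) b) has_derivative (\<lambda>h. g' b (fst h))) (at z)" if "b \<in> frame" for b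
    by (rule has_derivative_compose[OF has_derivative_fst[OF has_derivative_ident] assms[OF that]])
  then show ?thesis
    unfolding frame_adjoint_def
    by (intro has_derivative_sum has_derivative_scaleR_left has_derivative_inner
        has_derivative_snd has_derivative_ident)
qed

text \<open>The fibre part of a transition contains the first derivative of a base transition. Its
  differentiability therefore draws on second derivatives on the base.\<close>

sublocale cot: diff_atlas "cotangent_atlas A"
proof
  fix C D assume "C \<in> cotangent_atlas A" "D \<in> cotangent_atlas A"
  then obtain c d where cd: "c \<in> A" "d \<in> A" and CD: "C = cot_chart c" "D = cot_chart d"
    by (auto simp: cotangent_atlas_def)
  show "open (snd C ` (fst C \<inter> fst D))"
    using cd open_overlap by (simp add: CD cot_chart_overlap_image open_Times)
  fix z assume z: "z \<in> fst C" "z \<in> fst D"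
  obtain q \<xi> where q: "q \<in> fst c" and z_eq: "z = (q, coord_covector A c q \<xi>)"
    using cot_chart_cases[OF cd(1)] z(1) CD by blast
  have qd: "q \<in> fst d"
    using z(2) by (simp add: CD z_eq fst_cot_chart)
  let ?\<tau> = "snd d \<circ> chart_inv c"
  let ?g = "\<lambda>x. frechet_derivative (snd c \<circ> chart_inv d) (at (?\<tau> x))"
  let ?f = "\<lambda>y. (?\<tau> (fst y), frame_adjoint (?g (fst y)) (snd y))"
  have "(\<lambda>x. ?g x b) differentiable (at (snd c q))" for b
  proof -
    have "Ck_on (Suc (Suc 0)) (snd d ` (fst d \<inter> fst c)) (snd c \<circ> chart_inv d)"
      using transition_smooth[OF cd(2,1)] unfolding smooth_on_def by blast
    then have "(\<lambda>y. frechet_derivative (snd c \<circ> chart_inv d) (at y) b) differentiable (at (?\<tau> (snd c q)))"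
      using q qd cd by (simp add: chart_inv_chart)
    from differentiable_chain_at[OF transition_differentiable[OF cd q qd] this] show ?thesis
      by (simp add: o_def)
  qed
  then obtain g' where g': "((\<lambda>x. ?g x b) has_derivative g' b) (at (snd c q))" for b
    unfolding differentiable_def by metis
  have "((\<lambda>y. frame_adjoint (?g (fst y)) (snd y)) has_derivative
      (\<lambda>h. \<Sum>b\<in>frame. (snd (snd c q, \<xi>) \<bullet> g' b (fst h) + snd h \<bullet> ?g (fst (snd c q, \<xi>)) b) *\<^sub>R b)) (at (snd c q, \<xi>))"
    by (rule frame_adjoint_has_derivative) (simp add: g'[unfolded o_def])
  moreover have "((\<lambda>y. ?\<tau> (fst y)) has_derivative (\<lambda>h. transition_deriv c d q (fst h))) (at (snd c q, \<xi>))"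
    using transition_has_derivative[OF cd q qd]
    by (intro has_derivative_compose[OF has_derivative_fst[OF has_derivative_ident]])
      (simp only: fst_conv)
  note has_derivative_Pair[OF this calculation]
  then obtain f' where "(?f has_derivative f') (at (snd c q, \<xi>))"
    by blast
  then have "((snd D \<circ> chart_inv C) has_derivative f') (at (snd c q, \<xi>))"
  proof (rule has_derivative_transform_within_open)
    show "open (snd c ` (fst c \<inter> fst d) \<times> (UNIV :: 'e set))"
      using open_overlap[OF cd] by (simp add: open_Times)
    show "?f y = (snd D \<circ> chart_inv C) y" if "y \<in> snd c ` (fst c \<inter> fst d) \<times> UNIV" for y
      using that cd cot_transition[OF cd] by (auto simp: CD chart_inv_chart)
  qed (use q qd in auto)
  then show "(snd D \<circ> chart_inv C) differentiable (at (snd C z))"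
    unfolding differentiable_def using q cd by (auto simp: CD z_eq snd_cot_chart)
qed (auto simp: cotangent_atlas_def cot_chart_inj)

section \<open>The tautological and the symplectic form in coordinates\<close>

lemma cot_atlasI: "c \<in> A \<Longrightarrow> cot_chart c \<in> cotangent_atlas A"
  by (simp add: cotangent_atlas_def)

text \<open>In these charts the bundle projection is \<open>fst\<close>, so its differential
  extracts the base component of \<open>v\<close>, and the covector pairs \<open>\<xi>\<close> with
  that component.\<close>

lemma tautological_form_coords:
  assumes "c \<in> A" "q \<in> fst c" "v \<in> tangent_space (cotangent_atlas A) (q, coord_covector A c q \<xi>)"
  shows "tautological_form A (q, coord_covector A c q \<xi>) v = \<xi> \<bullet> fst (v (cot_chart c))"
proof -
  let ?z = "(q, coord_covector A c q \<xi>)"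
  have z: "?z \<in> fst (cot_chart c)"
    using assms by (simp add: coord_covector_mem)
  have ev: "\<forall>\<^sub>F x in nhds (snd (cot_chart c) ?z). x \<in> snd c ` fst c \<times> UNIV"
    using assms open_chart by (intro eventually_nhds_in_open open_Times) (auto simp: snd_cot_chart)
  have D: "((snd c \<circ> fst \<circ> chart_inv (cot_chart c)) has_derivative fst) (at (snd (cot_chart c) ?z))"
  proof (rule has_derivative_eventually_eq[OF has_derivative_fst[OF has_derivative_ident]])
    show "\<forall>\<^sub>F x in nhds (snd (cot_chart c) ?z). fst x = (snd c \<circ> fst \<circ> chart_inv (cot_chart c)) x"
      using ev by eventually_elim (auto simp: cot_chart_inv assms chart_inv_chart)
  qed
  have "differential (cotangent_atlas A) A fst ?z v = coord_vector A c (fst ?z) (fst (v (cot_chart c)))"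
  proof (rule differential_eq[OF cot.diff_atlas_axioms diff_atlas_axioms cot_atlasI z _ _ _ D assms(3)])
    show "\<forall>\<^sub>F x in nhds (snd (cot_chart c) ?z). fst (chart_inv (cot_chart c) x) \<in> fst c"
      using ev by eventually_elim (auto simp: cot_chart_inv assms chart_inv_chart)
  qed (use assms in auto)
  then show ?thesis
    using assms by (simp add: tautological_form_def coord_covector_coord_vector)
qed

text \<open>\<open>exterior_derivative\<close> works in the chart picked by \<open>chart_at\<close>,
  hence the hypothesis on \<open>c\<close>. There the form on a constant vector \<open>u\<close> is
  \<open>snd x \<bullet> fst u\<close>, linear in \<open>x\<close> and so its own derivative; the
  minus sign in the definition fixes the order of the two terms.\<close>

lemma canonical_symplectic_form_coords:
  assumes "c \<in> A" "z \<in> fst (cot_chart c)" "chart_at (cotangent_atlas A) z = cot_chart c"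
  shows "canonical_symplectic_form A z v w =
    snd (w (cot_chart c)) \<bullet> fst (v (cot_chart c)) - snd (v (cot_chart c)) \<bullet> fst (w (cot_chart c))"
proof -
  let ?C = "cot_chart c"
  let ?\<omega> = "\<lambda>u x. tautological_form A (chart_inv ?C x) (coord_vector (cotangent_atlas A) ?C (chart_inv ?C x) u)"
  have "(?\<omega> u has_derivative (\<lambda>h. snd h \<bullet> fst u)) (at (snd ?C z))" for u
  proof (rule has_derivative_transform_within_open)
    show "((\<lambda>x. snd x \<bullet> fst u) has_derivative (\<lambda>h. snd h \<bullet> fst u)) (at (snd ?C z))"
      by (auto intro!: derivative_eq_intros)
    show "open (snd ?C ` fst ?C)"
      by (rule cot.open_chart[OF cot_atlasI[OF assms(1)]])
    show "snd ?C z \<in> snd ?C ` fst ?C"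
      using assms(2) by simp
    fix x assume x: "x \<in> snd ?C ` fst ?C"
    then obtain q \<xi> where q: "q \<in> fst c" and x_eq: "x = (snd c q, \<xi>)"
      using cot_chart_image[OF assms(1)] by auto
    have inv: "chart_inv ?C x = (q, coord_covector A c q \<xi>)"
      using q assms(1) by (simp add: x_eq cot_chart_inv chart_inv_chart)
    have m: "(q, coord_covector A c q \<xi>) \<in> fst ?C"
      using q by (rule coord_covector_mem)
    show "snd x \<bullet> fst u = ?\<omega> u x"
      unfolding inv
      by (simp add: x_eq tautological_form_coords[OF assms(1) q
            cot.coord_vector_tangent[OF cot_atlasI[OF assms(1)] m]]
          cot.coord_vector_self[OF cot_atlasI[OF assms(1)] m])
  qed
  then have "frechet_derivative (?\<omega> u) (at (snd ?C z)) = (\<lambda>h. snd h \<bullet> fst u)" for u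
    by (rule frechet_derivative_eqI)
  then show ?thesis
    by (simp add: canonical_symplectic_form_def exterior_derivative_def assms(3) Let_def)
qed

end

subsection \<open>The lifted flow\<close>

lemma has_vector_derivative_quadratic:
  fixes g :: "real \<Rightarrow> 'e::real_normed_vector"
  assumes "\<forall>\<^sub>F t in nhds 0. norm (g t - g 0 - t *\<^sub>R v) \<le> C * t\<^sup>2"
  shows "(g has_vector_derivative v) (at 0)"
  unfolding has_vector_derivative_def has_derivative_at
proof
  show "((\<lambda>h. norm (g (0 + h) - g 0 - h *\<^sub>R v) / norm h) \<longlongrightarrow> 0) (at 0)"
  proof (rule Lim_null_comparison)
    have "\<forall>\<^sub>F h in at 0. norm (g h - g 0 - h *\<^sub>R v) \<le> C * h\<^sup>2"
      using assms eventually_nhds_conv_at by blast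
    then show "\<forall>\<^sub>F h in at 0. norm (norm (g (0 + h) - g 0 - h *\<^sub>R v) / norm h) \<le> C * \<bar>h\<bar>"
    proof eventually_elim
      case (elim h)
      then have "norm (g (0 + h) - g 0 - h *\<^sub>R v) \<le> (C * \<bar>h\<bar>) * \<bar>h\<bar>"
        by (simp add: power2_eq_square mult.assoc)
      then show ?case
        by (cases "h = 0") (simp_all add: divide_le_eq)
    qed
    show "((\<lambda>h::real. C * \<bar>h\<bar>) \<longlongrightarrow> 0) (at 0)"
      by (intro tendsto_mult_right_zero tendsto_rabs_zero tendsto_ident_at)
  qed
qed (rule bounded_linear_scaleR_left)

context complete_field
begin

definition lift_rep :: "('a, 'e) chart \<Rightarrow> 'e \<times> 'e \<Rightarrow> 'e \<times> 'e" where
  "lift_rep c z = (X_rep c (fst z), - frame_adjoint (frechet_derivative (X_rep c) (at (fst z))) (snd z))"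

text \<open>On the chart the inverse of the flow map is the flow at \<open>- t\<close>, with
  coordinate derivative \<open>D\<close> at the endpoint; precomposition of a covector with
  \<open>D\<close> is the transpose on its coordinates. By \<open>ev\<close>, points near the
  endpoint flow back into the same chart.\<close>

lemma lift_flow_coords:
  assumes c: "c \<in> A" "q \<in> fst c" "flow_of A X t q \<in> fst c"
    and ev: "\<forall>\<^sub>F x in nhds (snd c (flow_of A X t q)). x \<in> snd c ` fst c \<and> flow_of A X (- t) (chart_inv c x) \<in> fst c"
    and D: "((\<lambda>x. snd c (flow_of A X (- t) (chart_inv c x))) has_derivative D) (at (snd c (flow_of A X t q)))"
  shows "cotangent_lift A (flow_of A X t) (q, coord_covector A c q \<xi>)
    = (flow_of A X t q, coord_covector A c (flow_of A X t q) (frame_adjoint D \<xi>))"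
proof -
  let ?q = "flow_of A X t q" and ?F = "inv_into (carrier_of A) (flow_of A X t)"
  have carrier: "q \<in> carrier_of A" "?q \<in> carrier_of A"
    using c carrierI by blast+
  have Fq: "?F ?q = q"
    using carrier by (simp add: inv_flow flow_add flow_curve)
  have inv: "?F (chart_inv c x) = flow_of A X (- t) (chart_inv c x)" if "x \<in> snd c ` fst c" for x
    using carrierI[OF c(1) chart_inv_in[OF that]] by (rule inv_flow)
  have diff: "differential A A ?F ?q v = coord_vector A c q (D (v c))" if v: "v \<in> tangent_space A ?q" for v
  proof -
    have "differential A A ?F ?q v = coord_vector A c (?F ?q) (D (v c))"
    proof (rule differential_eq[OF diff_atlas_axioms diff_atlas_axioms c(1,3,1) _ _ _ v])
      show "?F ?q \<in> fst c"
        using c by (simp add: Fq)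
      show "\<forall>\<^sub>F x in nhds (snd c ?q). ?F (chart_inv c x) \<in> fst c"
        using ev by eventually_elim (simp add: inv)
      show "((snd c \<circ> ?F \<circ> chart_inv c) has_derivative D) (at (snd c ?q))"
      proof (rule has_derivative_eventually_eq[OF D])
        show "\<forall>\<^sub>F x in nhds (snd c ?q). snd c (flow_of A X (- t) (chart_inv c x)) = (snd c \<circ> ?F \<circ> chart_inv c) x"
          using ev by eventually_elim (simp add: inv)
      qed
    qed
    then show ?thesis
      by (simp add: Fq)
  qed
  have "(if v \<in> tangent_space A ?q then coord_covector A c q \<xi> (differential A A ?F ?q v) else 0)
    = coord_covector A c ?q (frame_adjoint D \<xi>) v" for v
    using diff[of v] coord_covector_coord_vector[OF c(1,2)] frame_adjoint_inner[OF has_derivative_linear[OF D]]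
    by (simp add: coord_covector_def[of A c ?q])
  then show ?thesis
    by (simp add: cotangent_lift_def)
qed

text \<open>For small \<open>t\<close> the lifted curve stays in one bundle chart. Its base
  component is an integral curve, and its fibre component is differentiated through the derivative
  of the backward flow at the moved point.\<close>

lemma lift_has_derivative:
  assumes c: "c \<in> A" and z: "z \<in> fst (cot_chart c)"
  defines "\<gamma> \<equiv> \<lambda>t. cotangent_lift A (flow_of A X t) z"
  shows "\<gamma> 0 = z" "\<forall>\<^sub>F t in nhds 0. \<gamma> t \<in> fst (cot_chart c)"
    "((snd (cot_chart c) \<circ> \<gamma>) has_vector_derivative lift_rep c (snd (cot_chart c) z)) (at 0)"
proof -
  obtain q \<xi> where q: "q \<in> fst c" and z_eq: "z = (q, coord_covector A c q \<xi>)"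
    using cot_chart_cases[OF c z] .
  let ?x0 = "snd c q"
  let ?u = "\<lambda>s y. snd c (flow_of A X s (chart_inv c y))"
  let ?Df = "\<lambda>x. frechet_derivative (X_rep c) (at x)"
  obtain r K L N T where T: "0 < T" and sub: "ball ?x0 r \<subseteq> snd c ` fst c"
    and flow: "local_flow (X_rep c) ?Df ?x0 r K L N T ?u"
    and stay: "\<And>s y. y \<in> ball ?x0 (r/2) \<Longrightarrow> \<bar>s\<bar> \<le> T \<Longrightarrow> flow_of A X s (chart_inv c y) \<in> fst c"
    using flow_local[OF c q] by metis
  interpret local_flow "X_rep c" ?Df ?x0 r K L N T ?u
    by (rule flow)
  have x0: "?x0 \<in> ball ?x0 (r/2)" "?x0 \<in> snd c ` fst c"
    using nonneg(1) q by auto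
  have qc: "q \<in> carrier_of A"
    by (rule carrierI[OF c q])
  define x where "x t = snd c (flow_of A X t q)" for t
  have x_eq: "x t = ?u t ?x0" for t
    using c q by (simp add: x_def chart_inv_chart)
  have x_0: "x 0 = ?x0"
    using qc by (simp add: x_def flow_curve)
  have x_deriv: "(x has_vector_derivative X_rep c ?x0) (at 0)"
    using integral_curve_chart(2)[OF flow_curve(1)[OF qc] c, of 0] q qc
    unfolding x_def by (simp add: flow_curve)
  have x_near: "norm (x t - ?x0) \<le> K * \<bar>t\<bar>" if "\<bar>t\<bar> \<le> T" for t
    using u_near[OF x0(1) that] by (simp add: x_eq)
  \<comment> \<open>The times at which the estimates apply at the moved point: short enough, and
    with \<open>x t\<close> still in the half ball of admissible starting points.\<close>
  define ok where "ok t \<longleftrightarrow> \<bar>t\<bar> \<le> T \<and> x t \<in> ball ?x0 (r/2)" for t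
  have ok_ev: "\<forall>\<^sub>F t in nhds 0. ok t"
  proof -
    have "(x \<longlongrightarrow> x 0) (nhds 0)"
      using has_vector_derivative_continuous[OF x_deriv]
      by (simp add: isCont_def tendsto_at_iff_tendsto_nhds)
    then have "\<forall>\<^sub>F t in nhds 0. x t \<in> ball ?x0 (r/2)"
      using x0(1) x_0 by (intro topological_tendstoD) auto
    moreover have "\<forall>\<^sub>F t in nhds 0. \<bar>t\<bar> \<le> T"
      unfolding eventually_nhds_metric using T by (auto intro!: exI[of _ T])
    ultimately show ?thesis
      unfolding ok_def by eventually_elim simp
  qed
  have ok_0: "ok 0"
    using T x0(1) x_0 by (simp add: ok_def)
  have "\<exists>D. ok t \<longrightarrow> (?u (- t) has_derivative D) (at (x t)) \<and>
    (\<forall>h. norm (D h - h - (- t) *\<^sub>R ?Df ?x0 h)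
      \<le> \<bar>- t\<bar> * (2 * N * (norm (x t - ?x0) + K * \<bar>- t\<bar>) + 2 * L\<^sup>2 * \<bar>- t\<bar>) * norm h)" for t
    using u_has_derivative[of "x t" "- t"] unfolding ok_def abs_minus_cancel by blast
  then obtain D where D: "\<And>t. ok t \<Longrightarrow> (?u (- t) has_derivative D t) (at (x t))"
    and D_bound: "\<And>t h. ok t \<Longrightarrow> norm (D t h - h - (- t) *\<^sub>R ?Df ?x0 h)
      \<le> \<bar>- t\<bar> * (2 * N * (norm (x t - ?x0) + K * \<bar>- t\<bar>) + 2 * L\<^sup>2 * \<bar>- t\<bar>) * norm h"
    by metis
  \<comment> \<open>At \<open>t = 0\<close> the bound vanishes and forces the identity.\<close>
  have D_0: "D 0 h = h" for h
    using D_bound[OF ok_0, of h] by simp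
  have D_deriv: "((\<lambda>t. D t h) has_vector_derivative - ?Df ?x0 h) (at 0)" for h
  proof (rule has_vector_derivative_quadratic)
    show "\<forall>\<^sub>F t in nhds 0. norm (D t h - D 0 h - t *\<^sub>R (- ?Df ?x0 h)) \<le> ((4 * N * K + 2 * L\<^sup>2) * norm h) * t\<^sup>2"
      using ok_ev
    proof eventually_elim
      case (elim t)
      have "norm (D t h - D 0 h - t *\<^sub>R (- ?Df ?x0 h))
        \<le> \<bar>t\<bar> * (2 * N * (norm (x t - ?x0) + K * \<bar>t\<bar>) + 2 * L\<^sup>2 * \<bar>t\<bar>) * norm h"
        using D_bound[OF elim, of h] by (simp add: D_0)
      \<comment> \<open>The moved point is within \<open>K * \<bar>t\<bar>\<close> of
        \<open>?x0\<close>, so the error becomes quadratic in \<open>t\<close>.\<close>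
      also have "\<dots> \<le> \<bar>t\<bar> * (2 * N * (K * \<bar>t\<bar> + K * \<bar>t\<bar>) + 2 * L\<^sup>2 * \<bar>t\<bar>) * norm h"
        using x_near[of t] elim nonneg unfolding ok_def
        by (intro mult_right_mono mult_left_mono add_right_mono) auto
      also have "\<dots> = ((4 * N * K + 2 * L\<^sup>2) * norm h) * (\<bar>t\<bar> * \<bar>t\<bar>)"
        by (simp add: algebra_simps)
      finally show ?case
        by (simp add: power2_eq_square)
    qed
  qed
  have lift: "\<gamma> t = (flow_of A X t q, coord_covector A c (flow_of A X t q) (frame_adjoint (D t) \<xi>))"
    and in_c: "flow_of A X t q \<in> fst c" if t: "ok t" for t
  proof -
    show in_c: "flow_of A X t q \<in> fst c"
      using stay[OF x0(1), of t] t c q by (simp add: ok_def chart_inv_chart)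
    show "\<gamma> t = (flow_of A X t q, coord_covector A c (flow_of A X t q) (frame_adjoint (D t) \<xi>))"
      unfolding \<gamma>_def z_eq
    proof (rule lift_flow_coords[OF c q in_c])
      have "\<forall>\<^sub>F y in nhds (x t). y \<in> ball ?x0 (r/2)"
        using t by (intro eventually_nhds_in_open) (auto simp: ok_def)
      then show "\<forall>\<^sub>F y in nhds (snd c (flow_of A X t q)).
          y \<in> snd c ` fst c \<and> flow_of A X (- t) (chart_inv c y) \<in> fst c"
        unfolding x_def[symmetric]
      proof eventually_elim
        case (elim y)
        then show ?case
          using stay[OF elim, of "- t"] t half_ball[OF elim] sub by (auto simp: ok_def)
      qed
      show "(?u (- t) has_derivative D t) (at (snd c (flow_of A X t q)))"
        using D[OF t] by (simp add: x_def)
    qed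
  qed
  have frame_adjoint_id: "frame_adjoint (\<lambda>h. h) \<xi> = \<xi>"
    using parseval_frame by (simp add: frame_adjoint_def parseval_def)
  show "\<gamma> 0 = z"
    using lift[OF ok_0] qc D_0 by (simp add: frame_adjoint_id z_eq flow_curve ext[of "D 0" "\<lambda>h. h"])
  show "\<forall>\<^sub>F t in nhds 0. \<gamma> t \<in> fst (cot_chart c)"
    using ok_ev by eventually_elim (simp add: lift coord_covector_mem in_c)
  have z_coords: "snd (cot_chart c) z = (?x0, \<xi>)"
    using c q by (simp add: z_eq snd_cot_chart)
  have "((\<lambda>t. frame_adjoint (D t) \<xi>) has_vector_derivative - frame_adjoint (?Df ?x0) \<xi>) (at 0)"
  proof -
    have "((\<lambda>t. (\<xi> \<bullet> D t b) *\<^sub>R b) has_vector_derivative (\<xi> \<bullet> (- ?Df ?x0 b)) *\<^sub>R b) (at 0)" for b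
      by (rule bounded_linear.has_vector_derivative[OF _ D_deriv, of "\<lambda>y. (\<xi> \<bullet> y) *\<^sub>R b"])
        (intro bounded_linear_scaleR_const bounded_linear_inner_right)
    then have "((\<lambda>t. frame_adjoint (D t) \<xi>) has_vector_derivative (\<Sum>b\<in>frame. (\<xi> \<bullet> (- ?Df ?x0 b)) *\<^sub>R b)) (at 0)"
      unfolding frame_adjoint_def by (intro has_vector_derivative_sum)
    then show ?thesis
      by (simp add: frame_adjoint_def sum_negf)
  qed
  then have "((\<lambda>t. (x t, frame_adjoint (D t) \<xi>)) has_vector_derivative lift_rep c (snd (cot_chart c) z)) (at 0)"
    unfolding z_coords lift_rep_def fst_conv snd_conv by (rule has_vector_derivative_Pair[OF x_deriv])
  moreover have "\<forall>\<^sub>F t in nhds 0. (x t, frame_adjoint (D t) \<xi>) = (snd (cot_chart c) \<circ> \<gamma>) t"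
    using ok_ev by eventually_elim (simp add: lift snd_cot_chart[OF c in_c] x_def)
  ultimately show "((snd (cot_chart c) \<circ> \<gamma>) has_vector_derivative lift_rep c (snd (cot_chart c) z)) (at 0)"
    unfolding has_vector_derivative_def by (rule has_derivative_eventually_eq)
qed

lemma lift_field:
  assumes z: "z \<in> carrier_of (cotangent_atlas A)"
  defines "Y \<equiv> cotangent_lift_vector_field A X z"
  shows "Y \<in> tangent_space (cotangent_atlas A) z"
    and "\<And>c. c \<in> A \<Longrightarrow> z \<in> fst (cot_chart c) \<Longrightarrow> Y (cot_chart c) = lift_rep c (snd (cot_chart c) z)"
proof -
  let ?\<gamma> = "\<lambda>t. cotangent_lift A (flow_of A X t) z"
  \<comment> \<open>The candidate depends on the bundle chart \<open>C\<close> alone, so no base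
    chart has to be chosen for it.\<close>
  define v where "v C = (if C \<in> cotangent_atlas A \<and> z \<in> fst C then vector_derivative (snd C \<circ> ?\<gamma>) (at 0) else 0)" for C
  obtain c0 where "c0 \<in> A" "z \<in> fst (cot_chart c0)"
    using z by (auto simp: carrier_of_def cotangent_atlas_def)
  then have \<gamma>_0: "?\<gamma> 0 = z"
    by (rule lift_has_derivative(1))
  have v: "v (cot_chart c) = lift_rep c (snd (cot_chart c) z)"
    if "c \<in> A" "z \<in> fst (cot_chart c)" for c
    using that vector_derivative_at[OF lift_has_derivative(3)[OF that]] by (simp add: v_def cot_atlasI)
  have "has_velocity (cotangent_atlas A) ?\<gamma> 0 v"
  proof (rule cot.has_velocityI)
    fix C assume "C \<in> cotangent_atlas A" "?\<gamma> 0 \<in> fst C"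
    then obtain c where c: "c \<in> A" "C = cot_chart c" "z \<in> fst (cot_chart c)"
      using \<gamma>_0 by (auto simp: cotangent_atlas_def)
    show "\<forall>\<^sub>F t in nhds 0. ?\<gamma> t \<in> fst C"
      using lift_has_derivative(2)[OF c(1,3)] c(2) by simp
    show "((snd C \<circ> ?\<gamma>) has_vector_derivative v C) (at 0)"
      using lift_has_derivative(3)[OF c(1,3)] c v by simp
  qed (use \<gamma>_0 z in \<open>auto simp: v_def\<close>)
  moreover from this have "Y = v"
    unfolding Y_def cotangent_lift_vector_field_def by (rule cot.velocity_eqI)
  ultimately show "Y \<in> tangent_space (cotangent_atlas A) z"
    and "\<And>c. c \<in> A \<Longrightarrow> z \<in> fst (cot_chart c) \<Longrightarrow> Y (cot_chart c) = lift_rep c (snd (cot_chart c) z)"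
    using v \<gamma>_0 by (simp_all add: has_velocity_def)
qed

text \<open>The fibre component is linear in the fibre coordinate with first derivatives of
  \<open>X_rep c\<close> as coefficients, and these have every order of regularity as well.\<close>

lemma lift_rep_Ck:
  assumes "c \<in> A"
  shows "Ck_on k (snd c ` fst c \<times> UNIV) (lift_rep c)"
proof -
  let ?S = "snd c ` fst c"
  have S: "open ?S" "open (?S \<times> (UNIV :: 'e set))"
    using open_chart[OF assms] by (auto simp: open_Times)
  have snd: "Ck_on k (?S \<times> (UNIV :: 'e set)) snd"
    by (rule Ck_on_bounded_linear[OF bounded_linear_snd S(2)])
  have Df: "Ck_on k ?S (\<lambda>x. frechet_derivative (X_rep c) (at x) b)" for b
    by (rule Ck_on_SucD'[OF X_rep_Ck[OF assms]])
  \<comment> \<open>The minus sign of the fibre component is carried by the frame vectors.\<close>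
  have "Ck_on k (?S \<times> UNIV) (\<lambda>z. (snd z \<bullet> frechet_derivative (X_rep c) (at (fst z)) b) *\<^sub>R (- b))" for b
    by (rule Ck_on_compose_bounded_linear[OF bounded_linear_scaleR_left S(2)]
        bounded_bilinear.Ck_on_prod[OF bounded_bilinear_inner S(2) snd]
        Ck_on_fst[OF S(1) Df])+
  then have "Ck_on k (?S \<times> UNIV) (\<lambda>z. \<Sum>b\<in>frame. (snd z \<bullet> frechet_derivative (X_rep c) (at (fst z)) b) *\<^sub>R (- b))"
    by (intro Ck_on_sum S)
  then have "Ck_on k (?S \<times> UNIV) (\<lambda>z. (X_rep c (fst z), \<Sum>b\<in>frame. (snd z \<bullet> frechet_derivative (X_rep c) (at (fst z)) b) *\<^sub>R (- b)))"
    by (rule Ck_on_Pair[OF S(2) Ck_on_fst[OF S(1) X_rep_Ck[OF assms]]])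
  then show ?thesis
    by (simp add: lift_rep_def[abs_def] frame_adjoint_def sum_negf)
qed

section \<open>The Hamiltonian function and its differential\<close>

lemma hamiltonian_rep:
  assumes "c \<in> A" "y \<in> snd c ` fst c \<times> UNIV"
  shows "((\<lambda>(q, p). p (X q)) \<circ> chart_inv (cot_chart c)) y = snd y \<bullet> X_rep c (fst y)"
proof -
  have x: "fst y \<in> snd c ` fst c"
    using assms(2) by auto
  have "X (chart_inv c (fst y)) \<in> tangent_space A (chart_inv c (fst y))"
    by (rule X_tangent[OF carrierI[OF assms(1) chart_inv_in[OF x]]])
  then show ?thesis
    using cot_chart_inv[OF assms(1) x, of "snd y"] by (simp add: coord_covector_def)
qed

lemma lift_hamiltonian:
  "hamiltonian_vector_field (cotangent_atlas A) (canonical_symplectic_form A)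
     (cotangent_lift_vector_field A X) (\<lambda>(q, p). p (X q))"
  unfolding hamiltonian_vector_field_def
proof (intro conjI ballI)
  let ?H = "\<lambda>(q, p). p (X q)"
  show "smooth_vector_field (cotangent_atlas A) (cotangent_lift_vector_field A X)"
    unfolding smooth_vector_field_def
  proof (intro conjI ballI)
    fix C assume "C \<in> cotangent_atlas A"
    then obtain c where c: "c \<in> A" and C: "C = cot_chart c"
      by (auto simp: cotangent_atlas_def)
    have op: "open (snd C ` fst C)"
      unfolding C by (rule cot.open_chart[OF cot_atlasI[OF c]])
    have "lift_rep c y = cotangent_lift_vector_field A X (chart_inv C y) C" if y: "y \<in> snd C ` fst C" for y
    proof -
      have m: "chart_inv C y \<in> fst C"
        by (rule cot.chart_inv_in[OF y])
      then have "cotangent_lift_vector_field A X (chart_inv C y) C = lift_rep c (snd C (chart_inv C y))"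
        using lift_field(2)[OF cot.carrierI[OF cot_atlasI[OF c]] c] by (simp add: C)
      then show ?thesis
        by (simp add: cot.chart_chart_inv[OF y])
    qed
    then have "Ck_on k (snd C ` fst C) (lift_rep c)
        \<longleftrightarrow> Ck_on k (snd C ` fst C) (\<lambda>y. cotangent_lift_vector_field A X (chart_inv C y) C)" for k
      by (rule Ck_on_cong[OF op])
    moreover have "Ck_on k (snd C ` fst C) (lift_rep c)" for k
      using lift_rep_Ck[OF c] by (simp add: C cot_chart_image[OF c])
    ultimately have "Ck_on k (snd C ` fst C) (\<lambda>y. cotangent_lift_vector_field A X (chart_inv C y) C)" for k
      by blast
    then show "smooth_on (snd C ` fst C) (\<lambda>y. cotangent_lift_vector_field A X (chart_inv C y) C)"
      by (simp add: smooth_on_def)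
  qed (rule lift_field)
  show "smooth_function (cotangent_atlas A) ?H"
    unfolding smooth_function_def
  proof
    fix C assume "C \<in> cotangent_atlas A"
    then obtain c where c: "c \<in> A" and C: "C = cot_chart c"
      by (auto simp: cotangent_atlas_def)
    let ?S = "snd c ` fst c"
    have S: "open ?S" "open (?S \<times> (UNIV :: 'e set))"
      using open_chart[OF c] by (auto simp: open_Times)
    have "Ck_on k (?S \<times> UNIV) (\<lambda>y. snd y \<bullet> X_rep c (fst y))" for k
      by (rule bounded_bilinear.Ck_on_prod[OF bounded_bilinear_inner S(2)
            Ck_on_bounded_linear[OF bounded_linear_snd S(2)] Ck_on_fst[OF S(1) X_rep_Ck[OF c]]])
    moreover have "Ck_on k (?S \<times> UNIV) (?H \<circ> chart_inv C) \<longleftrightarrow> Ck_on k (?S \<times> UNIV) (\<lambda>y. snd y \<bullet> X_rep c (fst y))" for k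
      unfolding C by (rule Ck_on_cong[OF S(2) hamiltonian_rep[OF c]])
    ultimately have "Ck_on k (?S \<times> UNIV) (?H \<circ> chart_inv C)" for k
      by blast
    then show "smooth_on (snd C ` fst C) (?H \<circ> chart_inv C)"
      by (simp add: smooth_on_def C cot_chart_image[OF c])
  qed
  fix z w assume z: "z \<in> carrier_of (cotangent_atlas A)"
  obtain c where c: "c \<in> A" and C: "chart_at (cotangent_atlas A) z = cot_chart c"
    using cot.chart_at(1)[OF z] by (auto simp: cotangent_atlas_def)
  have zc: "z \<in> fst (cot_chart c)"
    using cot.chart_at(2)[OF z] C by simp
  obtain q \<xi> where q: "q \<in> fst c" and z_eq: "z = (q, coord_covector A c q \<xi>)"
    using cot_chart_cases[OF c zc] .
  let ?f = "X_rep c" and ?Df = "frechet_derivative (X_rep c) (at (snd c q))"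
  have coords: "snd (cot_chart c) z = (snd c q, \<xi>)"
    using c q by (simp add: z_eq snd_cot_chart)
  have Df: "(?f has_derivative ?Df) (at (fst (snd c q, \<xi>)))"
    using X_rep_has_derivative[OF c] q by simp
  have "((\<lambda>y. snd y \<bullet> ?f (fst y)) has_derivative (\<lambda>h. snd (snd c q, \<xi>) \<bullet> ?Df (fst h) + snd h \<bullet> ?f (fst (snd c q, \<xi>))))
      (at (snd c q, \<xi>))"
    by (intro has_derivative_inner has_derivative_snd has_derivative_ident
        has_derivative_compose[OF has_derivative_fst[OF has_derivative_ident] Df])
  then have "((?H \<circ> chart_inv (cot_chart c)) has_derivative
      (\<lambda>h. snd (snd c q, \<xi>) \<bullet> ?Df (fst h) + snd h \<bullet> ?f (fst (snd c q, \<xi>)))) (at (snd c q, \<xi>))"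
  proof (rule has_derivative_transform_within_open)
    show "open (snd c ` fst c \<times> (UNIV :: 'e set))"
      using open_chart[OF c] by (simp add: open_Times)
    show "(snd c q, \<xi>) \<in> snd c ` fst c \<times> UNIV"
      using q by simp
  qed (simp only: hamiltonian_rep[OF c])
  then have "function_differential (cotangent_atlas A) ?H z w
    = \<xi> \<bullet> ?Df (fst (w (cot_chart c))) + snd (w (cot_chart c)) \<bullet> ?f (snd c q)"
    using function_differential_eq[OF C] coords by simp
  moreover have "cotangent_lift_vector_field A X z (cot_chart c) = (?f (snd c q), - frame_adjoint ?Df \<xi>)"
    using lift_field(2)[OF z c zc] by (simp add: coords lift_rep_def)
  \<comment> \<open>The minus sign of the fibre component cancels that of the form, and the
    transpose moves \<open>?Df\<close> onto the base component of \<open>w\<close>.\<close>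
  ultimately show "canonical_symplectic_form A z (cotangent_lift_vector_field A X z) w
    = function_differential (cotangent_atlas A) ?H z w"
    by (simp add: canonical_symplectic_form_coords[OF c zc C]
        frame_adjoint_inner[OF has_derivative_linear[OF Df]])
qed

end

theorem mainTheorem8:
  fixes M :: "'a topology"
    and A :: "('a, 'e::{real_inner, banach}) chart set"
    and X :: "'a \<Rightarrow> (('a, 'e) chart \<Rightarrow> 'e)"
  assumes "smooth_manifold M A"
    and "smooth_vector_field A X"
    and "complete_vector_field A X"
  shows "hamiltonian_vector_field (cotangent_atlas A) (canonical_symplectic_form A)
           (cotangent_lift_vector_field A X) (\<lambda>(q, p). p (X q))"
proof -
  interpret complete_field M A X
    by unfold_locales (fact assms)+
  show ?thesis
    by (rule lift_hamiltonian)
qed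

end
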